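(* There exists an absolute constant $C>0$ such that the following holds. For every $n\in\mathbb{N}$ and every family $\mathcal{F}\subset\mathcal{P}([n])$, if $\mathcal{L}\subset\mathcal{P}([n])$ is the initial segment of the lexicographic ordering with $|\mathcal{L}|=|\mathcal{F}|$, then there exists a family $\mathcal{G}\subset\mathcal{P}([n])$ weakly isomorphic to $\mathcal{L}$ such that $$|\mathcal{F}\,\Delta\,\mathcal{G}|\le C\big(|\partial\mathcal{F}|-|\partial\mathcal{L}|\big).$$
   Context: $\mathcal{P}([n])$ is the power set of $[n]=\{1,\dots,n\}$, identified with $\{0,1\}^n$; $Q_n$ is the graph on $\mathcal{P}([n])$ in which $S,T$ are adjacent iff $|S\Delta T|=1$. For $\mathcal{F}\subset\mathcal{P}([n])$, the edge boundary $\partial\mathcal{F}$ is the set of edges of $Q_n$ joining a member of $\mathcal{F}$ to a non-member. The lexicographic ordering on $\mathcal{P}([n])$ is defined by $S>T$ iff $\min(S\Delta T)\in S$; the initial segment of size $m$ consists of the $m$ largest sets in this ordering. Families $\mathcal{F},\mathcal{G}\subset\mathcal{P}([n])$ are weakly isomorphic if $\mathcal{G}=\phi(\mathcal{F})$ for some automorphism $\phi$ of $Q_n$, i.e. there exist a permutation $\pi$ of $[n]$ and $D\subset[n]$ with $\mathcal{G}=\{\pi(S)\Delta D: S\in\mathcal{F}\}$, where $\pi(S)=\{\pi(i):i\in S\}$. *)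

theory Defs
  imports Complex_Main "HOL-Combinatorics.Permutations"
begin

definition cube_adj :: "nat \<Rightarrow> nat set \<Rightarrow> nat set \<Rightarrow> bool" where
  "cube_adj n S T \<longleftrightarrow>
     S \<in> Pow {1..n} \<and> T \<in> Pow {1..n} \<and> card (sym_diff S T) = 1"

text \<open>Edges are unordered pairs, so that each boundary edge is counted once.\<close>

definition edge_boundary :: "nat \<Rightarrow> nat set set \<Rightarrow> nat set set set" where
  "edge_boundary n F =
     {{S, T} | S T. cube_adj n S T \<and> S \<in> F \<and> T \<notin> F}"

text \<open>The condition \<open>S \<noteq> T\<close> is needed because \<open>Min {}\<close> is unspecified.\<close>

definition lex_greater :: "nat set \<Rightarrow> nat set \<Rightarrow> bool" where
  "lex_greater S T \<longleftrightarrow> S \<noteq> T \<and> Min (sym_diff S T) \<in> S"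

definition lex_initial_segment :: "nat \<Rightarrow> nat \<Rightarrow> nat set set \<Rightarrow> bool" where
  "lex_initial_segment n m L \<longleftrightarrow>
     L \<subseteq> Pow {1..n} \<and> card L = m \<and>
     (\<forall>S\<in>L. \<forall>T\<in>Pow {1..n} - L. lex_greater S T)"

definition cube_automorphism :: "nat \<Rightarrow> (nat set \<Rightarrow> nat set) \<Rightarrow> bool" where
  "cube_automorphism n \<phi> \<longleftrightarrow>
     bij_betw \<phi> (Pow {1..n}) (Pow {1..n}) \<and>
     (\<forall>S\<in>Pow {1..n}. \<forall>T\<in>Pow {1..n}.
        cube_adj n (\<phi> S) (\<phi> T) \<longleftrightarrow> cube_adj n S T)"

definition weakly_isomorphic :: "nat \<Rightarrow> nat set set \<Rightarrow> nat set set \<Rightarrow> bool" where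
  "weakly_isomorphic n F G \<longleftrightarrow> (\<exists>\<phi>. cube_automorphism n \<phi> \<and> G = \<phi> ` F)"


lemma lex_greater_total:
  assumes "finite S" "finite T" "S \<noteq> T"
  shows "lex_greater S T \<or> lex_greater T S"
proof -
  have "Min (sym_diff S T) \<in> sym_diff S T"
    using assms by (intro Min_in) auto
  then show ?thesis
    using assms(3) by (auto simp: lex_greater_def Un_commute)
qed

lemma lex_greater_asym:
  assumes "finite S" "finite T" "lex_greater S T"
  shows "\<not> lex_greater T S"
proof -
  have "Min (sym_diff S T) \<in> sym_diff S T"
    using assms by (intro Min_in) (auto simp: lex_greater_def)
  then show ?thesis
    using assms(3) by (auto simp: lex_greater_def Un_commute)
qed

lemma lex_greater_iff:
  assumes "finite S" "finite T"
  shows "lex_greater S T \<longleftrightarrow> (\<exists>a. a \<in> S \<and> a \<notin> T \<and> (\<forall>x<a. x \<in> S \<longleftrightarrow> x \<in> T))"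
proof
  assume *: "lex_greater S T"
  define a where "a = Min (sym_diff S T)"
  have fin: "finite (sym_diff S T)" using assms by simp
  have "a \<in> sym_diff S T"
    unfolding a_def using * fin by (intro Min_in) (auto simp: lex_greater_def)
  moreover have "a \<in> S" using * by (simp add: lex_greater_def a_def)
  moreover have "x \<in> S \<longleftrightarrow> x \<in> T" if "x < a" for x
    using Min_le[OF fin, of x] that unfolding a_def by fastforce
  ultimately show "\<exists>a. a \<in> S \<and> a \<notin> T \<and> (\<forall>x<a. x \<in> S \<longleftrightarrow> x \<in> T)" by blast
next
  assume "\<exists>a. a \<in> S \<and> a \<notin> T \<and> (\<forall>x<a. x \<in> S \<longleftrightarrow> x \<in> T)"
  then obtain a where a: "a \<in> S" "a \<notin> T" "\<And>x. x < a \<Longrightarrow> x \<in> S \<longleftrightarrow> x \<in> T" by blast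
  have "Min (sym_diff S T) = a"
  proof (rule Min_eqI)
    show "a \<le> y" if "y \<in> sym_diff S T" for y
      using that a(3)[of y] by (cases "y < a") auto
  qed (use assms a in auto)
  then show "lex_greater S T" using a by (auto simp: lex_greater_def)
qed

lemma lex_greater_trans:
  assumes "finite S" "finite T" "finite U" "lex_greater S T" "lex_greater T U"
  shows "lex_greater S U"
proof -
  obtain a where a: "a \<in> S" "a \<notin> T" "\<And>x. x < a \<Longrightarrow> x \<in> S \<longleftrightarrow> x \<in> T"
    using assms lex_greater_iff by blast
  obtain b where b: "b \<in> T" "b \<notin> U" "\<And>x. x < b \<Longrightarrow> x \<in> T \<longleftrightarrow> x \<in> U"
    using assms lex_greater_iff by blast
  have "min a b \<in> S \<and> min a b \<notin> U \<and> (\<forall>x<min a b. x \<in> S \<longleftrightarrow> x \<in> U)"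
    using a b by (cases a b rule: linorder_cases) auto
  then show ?thesis using assms lex_greater_iff by blast
qed

lemma lex_initial_segment_unique:
  assumes "lex_initial_segment n m L" "lex_initial_segment n m L'"
  shows "L = L'"
proof (rule ccontr)
  assume ne: "L \<noteq> L'"
  have sub: "L \<subseteq> Pow {1..n}" "L' \<subseteq> Pow {1..n}" and c: "card L = card L'"
    using assms by (auto simp: lex_initial_segment_def)
  have fin: "finite L" "finite L'"
    using sub by (auto intro: finite_subset)
  have "\<not> L \<subseteq> L'" "\<not> L' \<subseteq> L"
    using ne c fin card_subset_eq by metis+
  then obtain S T where "S \<in> L" "S \<notin> L'" "T \<in> L'" "T \<notin> L" by blast
  moreover from this have "finite S" "finite T"
    using sub by (meson PowD finite_atLeastAtMost finite_subset subsetD)+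
  ultimately show False
    using assms sub lex_greater_asym[of S T]
    unfolding lex_initial_segment_def by blast
qed

lemma lex_initial_segment_exists:
  assumes "m \<le> 2 ^ n"
  shows "\<exists>L. lex_initial_segment n m L"
  using assms
proof (induction m)
  case 0
  show ?case by (rule exI[of _ "{}"]) (simp add: lex_initial_segment_def)
next
  case (Suc m)
  then obtain L where L: "lex_initial_segment n m L" by auto
  let ?R = "Pow {1..n} - L"
  have finL: "finite L" and subL: "L \<subseteq> Pow {1..n}" and cL: "card L = m"
    using L by (auto simp: lex_initial_segment_def intro: finite_subset)
  have fin: "finite S" if "S \<in> Pow {1..n}" for S
    using that by (auto intro: finite_subset)
  have "L \<noteq> Pow {1..n}" using Suc.prems cL by (auto simp: card_Pow)
  then have ne: "?R \<noteq> {}" using subL by blast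
  have "\<exists>M\<in>?R. \<forall>T\<in>?R. \<not> lex_greater T M"
  proof -
    have "finite A \<Longrightarrow> A \<noteq> {} \<Longrightarrow> A \<subseteq> Pow {1..n} \<Longrightarrow> \<exists>M\<in>A. \<forall>T\<in>A. \<not> lex_greater T M" for A
    proof (induction A rule: finite_ne_induct)
      case (singleton S)
      then show ?case by (simp add: lex_greater_def)
    next
      case (insert S A)
      then obtain M where M: "M \<in> A" "\<forall>T\<in>A. \<not> lex_greater T M" by auto
      have finA: "\<forall>T\<in>insert S A. finite T" using insert.prems fin by blast
      show ?case
      proof (cases "lex_greater S M")
        case True
        have "\<not> lex_greater T S" if "T \<in> insert S A" for T
        proof
          assume TS: "lex_greater T S"
          then have "T \<in> A" using that by (auto simp: lex_greater_def)
          then show False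
            using lex_greater_trans[of T S M] TS True M finA by blast
        qed
        then show ?thesis by blast
      next
        case False
        then show ?thesis using M by blast
      qed
    qed
    then show ?thesis using ne by (meson Diff_subset finite_Diff finite_Pow_iff finite_atLeastAtMost)
  qed
  then obtain M where M: "M \<in> ?R" "\<forall>T\<in>?R. \<not> lex_greater T M" by blast
  have "lex_greater M T" if "T \<in> ?R" "T \<noteq> M" for T
    using that M lex_greater_total[of M T] fin by blast
  then have "lex_initial_segment n (Suc m) (insert M L)"
    using L M finL unfolding lex_initial_segment_def by auto
  then show ?case by blast
qed

lemma cube_automorphism_perm_translate:
  assumes p: "p permutes {1..n}" and D: "D \<subseteq> {1..n}"
  shows "cube_automorphism n (\<lambda>S. sym_diff (p ` S) D)"
proof -
  let ?f = "\<lambda>S. sym_diff (p ` S) D"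
  have inj: "inj p" using p by (rule permutes_inj)
  have diff: "sym_diff (?f S) (?f T) = p ` sym_diff S T" for S T
    using inj by (auto simp: image_Un image_set_diff)
  have into: "?f S \<in> Pow {1..n}" if "S \<in> Pow {1..n}" for S
    using that D permutes_image[OF p] by blast
  have "inj_on ?f (Pow {1..n})"
  proof (rule inj_onI)
    fix S T assume "?f S = ?f T"
    then have "p ` sym_diff S T = {}" using diff[of S T] by simp
    then show "S = T" by auto
  qed
  moreover have "?f ` Pow {1..n} \<subseteq> Pow {1..n}" using into by blast
  ultimately have bij: "bij_betw ?f (Pow {1..n}) (Pow {1..n})"
    unfolding bij_betw_def by (metis (no_types, lifting) endo_inj_surj finite_Pow_iff finite_atLeastAtMost)
  have cardeq: "card (sym_diff (?f S) (?f T)) = card (sym_diff S T)" for S T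
    unfolding diff using inj by (meson card_image inj_on_subset subset_UNIV)
  have "cube_adj n (?f S) (?f T) \<longleftrightarrow> cube_adj n S T"
    if "S \<in> Pow {1..n}" "T \<in> Pow {1..n}" for S T
    by (simp only: cube_adj_def cardeq into[OF that(1)] into[OF that(2)] that)
  then show ?thesis
    unfolding cube_automorphism_def using bij by (intro conjI ballI)
qed

lemma common_neighbour_cases:
  assumes "a \<notin> A" "b \<notin> A" "a \<noteq> b"
    and "card (sym_diff X (insert a A)) = 1" "card (sym_diff X (insert b A)) = 1"
  shows "X = A \<or> X = insert a (insert b A)"
proof -
  obtain u v where u: "sym_diff X (insert a A) = {u}" and v: "sym_diff X (insert b A) = {v}"
    using assms(4,5) by (auto simp: card_1_singleton_iff)
  have U: "x \<in> X \<longleftrightarrow> (x = a \<or> x \<in> A) \<noteq> (x = u)" for x using u by blast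
  have V: "x \<in> X \<longleftrightarrow> (x = b \<or> x \<in> A) \<noteq> (x = v)" for x using v by blast
  have "u = a \<or> u = b" using U[of u] V[of u] U[of a] V[of a] U[of b] V[of b] assms(1-3) by metis
  then show ?thesis
  proof
    assume "u = a"
    then show ?thesis using U assms by blast
  next
    assume "u = b"
    then show ?thesis using U assms by blast
  qed
qed

lemma cube_automorphism_imp_perm_translate:
  assumes "cube_automorphism n \<phi>"
  shows "\<exists>p D. p permutes {1..n} \<and> D \<subseteq> {1..n} \<and>
           (\<forall>S\<in>Pow {1..n}. \<phi> S = sym_diff (p ` S) D)"
proof -
  let ?V = "Pow {1..n}"
  define D where "D = \<phi> {}"
  define f where "f S = sym_diff (\<phi> S) D" for S
  have bij: "bij_betw \<phi> ?V ?V"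
    and adj: "\<And>S T. S \<in> ?V \<Longrightarrow> T \<in> ?V \<Longrightarrow> cube_adj n (\<phi> S) (\<phi> T) \<longleftrightarrow> cube_adj n S T"
    using assms by (auto simp: cube_automorphism_def)
  have into: "\<phi> S \<in> ?V" if "S \<in> ?V" for S using bij that by (rule bij_betw_apply)
  have D: "D \<subseteq> {1..n}" using into[of "{}"] by (simp add: D_def)
  have f_in: "f S \<in> ?V" if "S \<in> ?V" for S using into[OF that] D by (auto simp: f_def)
  have f_diff: "sym_diff (f S) (f T) = sym_diff (\<phi> S) (\<phi> T)" for S T by (auto simp: f_def)
  have f_adj: "card (sym_diff (f S) (f T)) = 1 \<longleftrightarrow> card (sym_diff S T) = 1"
    if "S \<in> ?V" "T \<in> ?V" for S T
    using adj[OF that] into that unfolding f_diff cube_adj_def by blast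
  have f_inj: "S = T" if "S \<in> ?V" "T \<in> ?V" "f S = f T" for S T
  proof -
    have "\<phi> S = \<phi> T" using f_diff[of S T] that(3) by blast
    then show ?thesis using bij that(1,2) by (meson bij_betw_imp_inj_on inj_onD)
  qed
  have f0: "f {} = {}" by (simp add: f_def D_def)
  have "\<exists>j. f {i} = {j}" if "i \<in> {1..n}" for i
    using f_adj[of "{i}" "{}"] that by (auto simp: f0 card_1_singleton_iff)
  then obtain q where q: "\<And>i. i \<in> {1..n} \<Longrightarrow> f {i} = {q i}" by metis
  define p where "p i = (if i \<in> {1..n} then q i else i)" for i
  have p: "f {i} = {p i}" if "i \<in> {1..n}" for i using q[OF that] that by (simp add: p_def)
  have p_in: "p i \<in> {1..n}" if "i \<in> {1..n}" for i
    using f_in[of "{i}"] p[OF that] that by simp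
  have p_inj: "inj_on p {1..n}"
  proof (rule inj_onI)
    fix i j assume ij: "i \<in> {1..n}" "j \<in> {1..n}" "p i = p j"
    then have "f {i} = f {j}" using p by simp
    then show "i = j" using f_inj[of "{i}" "{j}"] ij by auto
  qed
  have "bij_betw p {1..n} {1..n}"
    unfolding bij_betw_def using p_inj p_in by (meson endo_inj_surj finite_atLeastAtMost image_subsetI)
  then have perm: "p permutes {1..n}"
    by (rule bij_imp_permutes) (auto simp: p_def)
  have f_eq: "f S = p ` S" if "S \<in> ?V" for S
    using that
  proof (induction "card S" arbitrary: S rule: less_induct)
    case less
    have finS: "finite S" using less.prems by (auto intro: finite_subset)
    consider "S = {}" | i where "S = {i}" | a b where "a \<in> S" "b \<in> S" "a \<noteq> b"
      by blast
    then show ?case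
    proof cases
      case 1
      then show ?thesis using f0 by simp
    next
      case 2
      then show ?thesis using p less.prems by simp
    next
      case 3
      let ?A = "S - {a, b}"
      have S: "S = insert a (insert b ?A)" using 3 by blast
      have V: "insert a ?A \<in> ?V" "insert b ?A \<in> ?V" "?A \<in> ?V" using less.prems 3 by auto
      have sub: "insert a ?A \<subset> S" "insert b ?A \<subset> S" "?A \<subset> S" using 3 by auto
      have lt: "card (insert a ?A) < card S" "card (insert b ?A) < card S" "card ?A < card S"
        by (meson psubset_card_mono[OF finS] sub)+
      note IH = less.hyps[OF lt(1) V(1)] less.hyps[OF lt(2) V(2)] less.hyps[OF lt(3) V(3)]
      have "sym_diff S (insert a ?A) = {b}" "sym_diff S (insert b ?A) = {a}" using 3 by auto
      then have c: "card (sym_diff (f S) (f (insert a ?A))) = 1"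
        "card (sym_diff (f S) (f (insert b ?A))) = 1"
        using f_adj[OF less.prems V(1)] f_adj[OF less.prems V(2)] by simp_all
      have pinj: "inj p" using perm by (rule permutes_inj)
      have "f S = p ` ?A \<or> f S = insert (p a) (insert (p b) (p ` ?A))"
      proof (rule common_neighbour_cases)
        show "p a \<notin> p ` ?A" "p b \<notin> p ` ?A" "p a \<noteq> p b"
          using pinj 3 by (auto dest: injD)
      qed (use c IH in simp_all)
      moreover have "f S \<noteq> p ` ?A"
        using f_inj[OF less.prems V(3)] IH(3) 3 by auto
      ultimately have "f S = p ` insert a (insert b ?A)" by simp
      then show ?thesis using S by simp
    qed
  qed
  have "\<phi> S = sym_diff (p ` S) D" if "S \<in> ?V" for S
    using f_eq[OF that] by (auto simp: f_def)
  then show ?thesis using perm D by blast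
qed

lemma weakly_isomorphic_iff:
  assumes "F \<subseteq> Pow {1..n}"
  shows "weakly_isomorphic n F G \<longleftrightarrow>
    (\<exists>p D. p permutes {1..n} \<and> D \<subseteq> {1..n} \<and> G = {sym_diff (p ` S) D | S. S \<in> F})"
proof
  assume "weakly_isomorphic n F G"
  then obtain \<phi> where "cube_automorphism n \<phi>" and G: "G = \<phi> ` F"
    by (auto simp: weakly_isomorphic_def)
  then obtain p D where pD: "p permutes {1..n}" "D \<subseteq> {1..n}"
    and eq: "\<forall>S\<in>Pow {1..n}. \<phi> S = sym_diff (p ` S) D"
    by (elim cube_automorphism_imp_perm_translate[THEN exE] exE conjE) (rule that)
  have "G = (\<lambda>S. sym_diff (p ` S) D) ` F"
    unfolding G by (rule image_cong) (use eq assms in auto)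
  then have "G = {sym_diff (p ` S) D | S. S \<in> F}" by (simp add: image_def Bex_def conj_commute)
  then show "\<exists>p D. p permutes {1..n} \<and> D \<subseteq> {1..n} \<and> G = {sym_diff (p ` S) D | S. S \<in> F}"
    using pD by blast
next
  assume "\<exists>p D. p permutes {1..n} \<and> D \<subseteq> {1..n} \<and> G = {sym_diff (p ` S) D | S. S \<in> F}"
  then obtain p D where pD: "p permutes {1..n}" "D \<subseteq> {1..n}"
    and "G = {sym_diff (p ` S) D | S. S \<in> F}" by blast
  then have "G = (\<lambda>S. sym_diff (p ` S) D) ` F" by blast
  then show "weakly_isomorphic n F G"
    unfolding weakly_isomorphic_def using cube_automorphism_perm_translate[OF pD] by blast
qed

end

theory Submission
  imports Defs
begin

text \<open>
  Normalise by \<open>2 ^ n\<close>. The boundary of an initial segment of density \<open>x\<close> is the Takagi function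
  \<open>T x\<close>. Splitting a family of density \<open>(x + y) / 2\<close> along a coordinate into halves of densities
  \<open>x \<ge> y\<close>, its deficit (boundary minus \<open>T\<close>) is the mean of the deficits of the halves, plus the part of
  the light half outside the heavy one, plus the gap \<open>(T x + T y) / 2 + (x - y) / 2 - T ((x + y) / 2)\<close>.
  If \<open>y\<close> is at most a constant times what the split contributes beyond the heavy half, the theorem
  passes from the heavy half to the whole family by induction. So it suffices to find such a
  coordinate, or to be close to a subcube.

  The gap is self-similar under doubling, and quantitatively positive if \<open>x\<close> and \<open>y\<close> are on different
  sides of \<open>1/2\<close>. This makes any moderately light side of a nearly extremal family very light, except
  when the density is just above a power of two, where one compares with a subcube. A moderately
  light side is found by induction: replacing \<open>T x\<close> by \<open>x log (1/x)\<close> gives stability around subcubes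
  at once, which settles densities near powers of two. Between them, either some coordinate has
  tiny influence, so that one of the halves has no larger relative deficit, or the heavy half is
  denser by a constant factor, which pays for its relative deficit being up to twice as large.
\<close>

section \<open>The Takagi function\<close>

definition dist_int :: "real \<Rightarrow> real" where
  "dist_int x = \<bar>x - of_int (round x)\<bar>"

lemma dist_int_le: "dist_int x \<le> \<bar>x - of_int m\<bar>"
  unfolding dist_int_def by (metis abs_minus_commute round_diff_minimal)

lemma dist_int_nonneg: "0 \<le> dist_int x"
  by (simp add: dist_int_def)

lemma dist_int_le_half: "dist_int x \<le> 1/2"
  unfolding dist_int_def using of_int_round_abs_le[of x] by (simp add: abs_minus_commute)

lemma dist_int_eqI:
  assumes "\<And>m. a \<le> \<bar>x - of_int m\<bar>" "\<bar>x - of_int k\<bar> = a"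
  shows "dist_int x = a"
  using assms(1)[of "round x"] assms(2) dist_int_le[of x k] by (simp add: dist_int_def)

lemma dist_int_low: "0 \<le> x \<Longrightarrow> x \<le> 1/2 \<Longrightarrow> dist_int x = x"
proof (rule dist_int_eqI[where k = 0])
  fix m :: int assume "0 \<le> x" "x \<le> 1/2"
  moreover have "of_int m \<le> (0::real) \<or> of_int m \<ge> (1::real)"
    by (cases "m \<le> 0") auto
  ultimately show "x \<le> \<bar>x - of_int m\<bar>" by linarith
qed auto

lemma dist_int_minus: "dist_int (- x) = dist_int x"
proof -
  have "dist_int (- x) \<le> dist_int x" for x
    using dist_int_le[of "- x" "- round x"] by (simp add: dist_int_def abs_minus_commute)
  from this[of x] this[of "- x"] show ?thesis by simp
qed

lemma dist_int_plus_int: "dist_int (x + of_int k) = dist_int x"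
proof -
  have "dist_int (x + of_int k) \<le> dist_int x" for x k
    using dist_int_le[of "x + of_int k" "round x + k"] by (simp add: dist_int_def)
  from this[of x k] this[of "x + of_int k" "- k"] show ?thesis by simp
qed

lemma dist_int_high:
  assumes "1/2 \<le> x" "x \<le> 1"
  shows "dist_int x = 1 - x"
proof -
  have "dist_int x = dist_int (- x)" by (simp add: dist_int_minus)
  also have "\<dots> = dist_int (- x + of_int 1)" by (rule dist_int_plus_int[symmetric])
  also have "\<dots> = 1 - x" using dist_int_low[of "1 - x"] assms by simp
  finally show ?thesis .
qed

lemma dist_int_subadd: "dist_int (x + y) \<le> dist_int x + dist_int y"
  using dist_int_le[of "x + y" "round x + round y"] by (simp add: dist_int_def)

text \<open>The blancmange series, taken on all of the reals: it is even and has period 1, so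
  reflections \<open>1 - x\<close> and shifts such as \<open>2 * x - 1\<close> are plain
  rewriting.\<close>

definition tak :: "real \<Rightarrow> real" where
  "tak x = (\<Sum>n. dist_int (2 ^ n * x) / 2 ^ n)"

lemma summable_half_powers: "summable (\<lambda>n. c / 2 ^ n :: real)"
  using summable_mult[OF summable_geometric[of "1/2::real"], of c] by (simp add: power_one_over field_simps)

lemma suminf_half_powers: "(\<Sum>n. c / 2 ^ n :: real) = 2 * c"
  using suminf_mult[OF summable_geometric[of "1/2::real"], of c] suminf_geometric[of "1/2::real"]
  by (simp add: power_one_over field_simps)

lemma summable_tak: "summable (\<lambda>n. dist_int (2 ^ n * x) / 2 ^ n)"
proof (rule summable_comparison_test[OF _ summable_half_powers[of "1/2"]])
  have "norm (dist_int (2 ^ n * x) / 2 ^ n) \<le> (1/2) / 2 ^ n" for n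
    using divide_right_mono[OF dist_int_le_half[of "2 ^ n * x"], of "2 ^ n"]
    by (simp add: dist_int_nonneg abs_of_nonneg)
  then show "\<exists>N. \<forall>n\<ge>N. norm (dist_int (2 ^ n * x) / 2 ^ n) \<le> (1/2) / 2 ^ n" by blast
qed

lemma tak_rec: "tak x = dist_int x + tak (2 * x) / 2"
proof -
  have "tak x = dist_int x + (\<Sum>n. dist_int (2 ^ Suc n * x) / 2 ^ Suc n)"
    unfolding tak_def using suminf_split_head[OF summable_tak[of x]] by simp
  also have "(\<Sum>n. dist_int (2 ^ Suc n * x) / 2 ^ Suc n) = (\<Sum>n. (dist_int (2 ^ n * (2 * x)) / 2 ^ n) / 2)"
    by (simp add: mult_ac)
  also have "\<dots> = tak (2 * x) / 2"
    unfolding tak_def by (rule suminf_divide[OF summable_tak])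
  finally show ?thesis .
qed

lemma tak_nonneg: "0 \<le> tak x"
  unfolding tak_def by (rule suminf_nonneg[OF summable_tak]) (simp add: dist_int_nonneg)

lemma tak_le_1: "tak x \<le> 1"
proof -
  have "tak x \<le> (\<Sum>n. (1/2) / 2 ^ n)"
    unfolding tak_def
    by (intro suminf_le summable_tak summable_half_powers divide_right_mono dist_int_le_half) auto
  then show ?thesis by (simp only: suminf_half_powers)
qed

lemma tak_minus: "tak (- x) = tak x"
  by (simp add: tak_def dist_int_minus)

lemma tak_plus_int: "tak (x + of_int k) = tak x"
  unfolding tak_def
  using dist_int_plus_int[of "2 ^ n * x" "2 ^ n * k" for n] by (simp add: distrib_left)

lemma tak_reflect: "tak (1 - x) = tak x"
  using tak_plus_int[of "- x" 1] by (simp add: tak_minus add.commute)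

lemma tak_subadd: "tak (x + y) \<le> tak x + tak y"
proof -
  have "tak (x + y) \<le> (\<Sum>n. dist_int (2 ^ n * x) / 2 ^ n + dist_int (2 ^ n * y) / 2 ^ n)"
    unfolding tak_def
  proof (intro suminf_le summable_tak summable_add)
    fix n
    show "dist_int (2 ^ n * (x + y)) / 2 ^ n \<le> dist_int (2 ^ n * x) / 2 ^ n + dist_int (2 ^ n * y) / 2 ^ n"
      using dist_int_subadd[of "2 ^ n * x" "2 ^ n * y"]
      by (simp add: distrib_left divide_right_mono flip: add_divide_distrib)
  qed
  then show ?thesis unfolding tak_def by (simp add: suminf_add[OF summable_tak summable_tak])
qed

lemma tak_diff: "tak (x - y) \<le> tak x + tak y"
  using tak_subadd[of x "- y"] by (simp add: tak_minus)

lemma tak_0 [simp]: "tak 0 = 0"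
  using tak_rec[of 0] dist_int_low[of 0] by simp

lemma tak_1 [simp]: "tak 1 = 0"
  using tak_reflect[of 0] by simp

lemma tak_low: "0 \<le> x \<Longrightarrow> x \<le> 1/2 \<Longrightarrow> tak x = x + tak (2 * x) / 2"
  by (metis tak_rec dist_int_low)

lemma tak_high: "1/2 \<le> x \<Longrightarrow> x \<le> 1 \<Longrightarrow> tak x = 1 - x + tak (2 * x) / 2"
  by (metis tak_rec dist_int_high)

lemma tak_double_minus_1: "tak (2 * x - 1) = tak (2 * x)"
  using tak_plus_int[of "2 * x" "-1"] by simp

lemma tak_ge: "0 \<le> x \<Longrightarrow> x \<le> 1/2 \<Longrightarrow> x \<le> tak x"
  using tak_low[of x] tak_nonneg[of "2 * x"] by simp

text \<open>Iterates \<open>tak_low\<close>: each of the \<open>m\<close> halvings contributes the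
  same linear amount \<open>x / 2 ^ m\<close>, the dyadic counterpart of x log (1/x).\<close>

lemma tak_scale:
  assumes "0 \<le> x" "x \<le> 1"
  shows "tak (x / 2 ^ m) = (tak x + m * x) / 2 ^ m"
proof (induction m)
  case (Suc m)
  have "(1::real) \<le> 2 ^ m" by simp
  then have "x \<le> 2 ^ m" using assms by linarith
  then have "tak (x / 2 ^ Suc m) = x / 2 ^ Suc m + tak (x / 2 ^ m) / 2"
    using tak_low[of "x / 2 ^ Suc m"] assms by (simp add: field_simps)
  then show ?case using Suc.IH by (simp add: field_simps)
qed simp

lemma tak_small:
  assumes "0 \<le> q" "q \<le> 1 / 2 ^ m"
  shows "tak q \<le> (m + 1) / 2 ^ m"
proof -
  have q: "2 ^ m * q \<le> 1" using assms by (simp add: field_simps)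
  have "tak q = (tak (2 ^ m * q) + m * (2 ^ m * q)) / 2 ^ m"
    using tak_scale[of "2 ^ m * q" m] assms q by simp
  also have "\<dots> \<le> (1 + m * 1) / 2 ^ m"
    using mult_left_mono[OF q, of "real m"] tak_le_1[of "2 ^ m * q"]
    by (intro divide_right_mono add_mono) auto
  finally show ?thesis by (simp add: add.commute)
qed

text \<open>Monotone up to a factor 2: on [1/4, 1/2] the values of \<open>tak\<close> lie between
  1/2 and 1, and doubling carries a smaller \<open>x\<close> into that range.\<close>

lemma tak_le_double:
  assumes "0 \<le> x'" "x' \<le> x" "x \<le> 1/2"
  shows "tak x' \<le> 2 * tak x"
proof -
  have *: "tak x' \<le> 2 * tak x" if "1 / 2 ^ (m + 2) < x" "0 \<le> x'" "x' \<le> x" "x \<le> 1/2" for m x x'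
    using that
  proof (induction m arbitrary: x x')
    case 0
    have "tak x \<ge> 1/2" using 0 tak_low[of x] tak_high[of "2 * x"] tak_nonneg[of "2 * (2 * x)"] by (simp add: field_simps)
    then show ?case using tak_le_1[of x'] by linarith
  next
    case (Suc m)
    show ?case
    proof (cases "x \<le> 1/4")
      case True
      have "tak (2 * x') \<le> 2 * tak (2 * x)" using Suc True by (intro Suc.IH) (auto simp: field_simps)
      then show ?thesis using tak_low[of x] tak_low[of x'] Suc.prems by simp
    next
      case False
      then have "tak x \<ge> 1/2" using Suc.prems tak_low[of x] tak_high[of "2 * x"] tak_nonneg[of "2 * (2 * x)"] by (simp add: field_simps)
      then show ?thesis using tak_le_1[of x'] by linarith
    qed
  qed
  show ?thesis
  proof (cases "x = 0")
    case False
    then obtain m where "(1/2) ^ m < x" using assms real_arch_pow_inv[of x "1/2"] by auto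
    moreover have "1 / 2 ^ (m + 2) \<le> (1/2::real) ^ m" by (simp add: power_one_over field_simps)
    ultimately show ?thesis using *[of m x x'] assms by linarith
  qed (use assms in auto)
qed

text \<open>Serves to absorb the Takagi value of an error into that of a much larger quantity; the
  linear terms of \<open>tak_scale\<close> are absorbed by \<open>x \<le> tak x\<close>.\<close>

lemma tak_rel_small:
  assumes "0 \<le> q" "q \<le> x / 2 ^ m" "x \<le> 1/2"
  shows "tak q \<le> (m + 2) / 2 ^ m * tak x"
proof -
  have q: "2 ^ m * q \<le> x" using assms by (simp add: field_simps)
  have x0: "0 \<le> x" using assms q by (smt (verit) zero_le_mult_iff zero_le_power)
  have "tak q = (tak (2 ^ m * q) + m * (2 ^ m * q)) / 2 ^ m"
    using tak_scale[of "2 ^ m * q" m] assms q by simp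
  also have "\<dots> \<le> (2 * tak x + m * tak x) / 2 ^ m"
    using tak_le_double[of "2 ^ m * q" x] tak_ge[of x] assms q x0
    by (intro divide_right_mono add_mono mult_left_mono) auto
  also have "\<dots> = (m + 2) / 2 ^ m * tak x" by (simp add: algebra_simps)
  finally show ?thesis by (simp add: add.commute)
qed

text \<open>The error term in the approximate midpoint convexity of the Takagi function.\<close>

definition tgap :: "real \<Rightarrow> real \<Rightarrow> real" where
  "tgap x y = (tak x + tak y) / 2 + \<bar>x - y\<bar> / 2 - tak ((x + y) / 2)"

lemma tgap_commute: "tgap x y = tgap y x"
  by (simp add: tgap_def add.commute abs_minus_commute)

lemma tgap_reflect: "tgap (1 - x) (1 - y) = tgap x y"
proof -
  have eq: "(1 - x + (1 - y)) / 2 = 1 - (x + y) / 2" by (simp add: field_simps)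
  show ?thesis unfolding tgap_def eq tak_reflect by (simp add: abs_minus_commute)
qed

lemma tgap_double:
  assumes "0 \<le> x" "x \<le> 1/2" "0 \<le> y" "y \<le> 1/2"
  shows "tgap (2 * x) (2 * y) = 2 * tgap x y"
  using tak_low[of x] tak_low[of y] tak_low[of "(x + y) / 2"] assms
  by (simp add: tgap_def field_simps abs_if)

lemma tgap_scale:
  assumes "0 \<le> x" "0 \<le> y" "2 ^ k * x \<le> 1" "2 ^ k * y \<le> 1"
  shows "tgap (2 ^ k * x) (2 ^ k * y) = 2 ^ k * tgap x y"
  using assms(3,4)
proof (induction k)
  case (Suc k)
  have "0 \<le> 2 ^ k * x" "0 \<le> 2 ^ k * y" using assms by auto
  moreover have "2 ^ k * x \<le> 1/2" "2 ^ k * y \<le> 1/2" using Suc.prems by auto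
  ultimately show ?case using tgap_double[of "2 ^ k * x" "2 ^ k * y"] Suc.IH by (simp add: mult.assoc)
qed simp

text \<open>The mean lies in [1/4, 3/4], where the first two terms of the Takagi series always add
  up to 1/2. All linear terms cancel and a quarter of the subadditivity defect of \<open>tak\<close>
  remains.\<close>

lemma tgap_straddle:
  assumes "0 \<le> y" "y \<le> 1/2" "1/2 \<le> x" "x \<le> 1"
  shows "tgap x y = (tak (2 * x) + tak (2 * y) - tak (2 * x + 2 * y)) / 4"
proof -
  define m where "m = (x + y) / 2"
  have "dist_int m + dist_int (2 * m) / 2 = 1/2"
  proof (cases "m \<le> 1/2")
    case True
    moreover have "1/2 \<le> 2 * m" "0 \<le> m" using assms by (simp_all add: m_def)
    ultimately show ?thesis using dist_int_low[of m] dist_int_high[of "2 * m"] by (simp add: field_simps)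
  next
    case False
    have "dist_int (2 * m) = dist_int (2 * m - 1)" using dist_int_plus_int[of "2 * m" "-1"] by simp
    moreover have "2 * m - 1 \<le> 1/2" using assms by (simp add: m_def)
    ultimately show ?thesis using False dist_int_high[of m] dist_int_low[of "2 * m - 1"] by (simp add: field_simps)
  qed
  moreover have "tak m = dist_int m + dist_int (2 * m) / 2 + tak (2 * (2 * m)) / 4"
    using tak_rec[of m] tak_rec[of "2 * m"] by simp
  moreover have "2 * (2 * m) = 2 * x + 2 * y" by (simp add: m_def)
  ultimately have "tak m = 1/2 + tak (2 * x + 2 * y) / 4" by metis
  then show ?thesis
    using tak_low[of y] tak_high[of x] assms by (simp add: tgap_def m_def field_simps)
qed

lemma tgap_nonneg:
  assumes "0 \<le> x" "x \<le> 1" "0 \<le> y" "y \<le> 1"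
  shows "0 \<le> tgap x y"
proof -
  \<comment> \<open>The error \<open>1 / 2 ^ m\<close> makes the start of the induction trivial.
    Doubling, if necessary after a reflection, halves it; a straddling pair is settled by
    subadditivity.\<close>
  have *: "- (1 / 2 ^ m) \<le> tgap x y" if "0 \<le> x" "x \<le> 1" "0 \<le> y" "y \<le> 1" for m x y
    using that
  proof (induction m arbitrary: x y)
    case 0
    then show ?case using tak_nonneg[of x] tak_nonneg[of y] tak_le_1[of "(x + y) / 2"]
      abs_ge_zero[of "x - y"] unfolding tgap_def by (simp add: field_simps)
  next
    case (Suc m)
    have straddle: "- (1 / 2 ^ Suc m) \<le> tgap x y" if "0 \<le> y" "y \<le> 1/2" "1/2 \<le> x" "x \<le> 1" for x y
      using tgap_straddle[OF that] tak_subadd[of "2 * x" "2 * y"]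
      by (smt (verit) divide_nonneg_nonneg zero_le_power)
    have low: "- (1 / 2 ^ Suc m) \<le> tgap x y" if "0 \<le> y" "y \<le> 1/2" "0 \<le> x" "x \<le> 1/2" for x y
      using Suc.IH[of "2 * x" "2 * y"] tgap_double[of x y] that by simp
    consider "x \<le> 1/2" "y \<le> 1/2" | "x \<ge> 1/2" "y \<le> 1/2" | "x \<le> 1/2" "y \<ge> 1/2" | "x \<ge> 1/2" "y \<ge> 1/2"
      by linarith
    then show ?case
    proof cases
      case 1 then show ?thesis using low Suc.prems by simp
    next
      case 2 then show ?thesis using straddle Suc.prems by simp
    next
      case 3 then show ?thesis using straddle[of x y] Suc.prems by (simp add: tgap_commute)
    next
      case 4 then show ?thesis using low[of "1 - y" "1 - x"] Suc.prems by (simp add: tgap_reflect)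
    qed
  qed
  show ?thesis
  proof (rule ccontr)
    assume "\<not> 0 \<le> tgap x y"
    then obtain m where "(1/2) ^ m < - tgap x y" using real_arch_pow_inv[of "- tgap x y" "1/2"] by auto
    then show False using *[OF assms, of m] by (simp add: power_one_over)
  qed
qed

text \<open>Quantitative subadditivity. If \<open>q - p \<ge> 1/2\<close>, the linear terms cancel
  and doubling reproduces the claim; otherwise the first two terms of the series already give the
  bound and subadditivity handles the tail.\<close>

lemma tak_diff_strict:
  assumes "0 \<le> p" "p \<le> q" "q \<le> 1"
  shows "min p (1 - q) \<le> tak p + tak q - tak (q - p)"
proof -
  have *: "min p (1 - q) - 2 / 2 ^ m \<le> tak p + tak q - tak (q - p)" if "0 \<le> p" "p \<le> q" "q \<le> 1" for m p q
    using that
  proof (induction m arbitrary: p q)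
    case 0
    then show ?case using tak_nonneg[of p] tak_nonneg[of q] tak_le_1[of "q - p"] by auto
  next
    case (Suc m)
    show ?case
    proof (cases "q - p \<ge> 1/2")
      case True
      have "min (2 * p) (1 - (2 * q - 1)) - 2 / 2 ^ m \<le> tak (2 * p) + tak (2 * q - 1) - tak (2 * q - 1 - 2 * p)"
        using Suc.prems True by (intro Suc.IH) auto
      moreover have "tak (2 * q - 1 - 2 * p) = tak (2 * (q - p))"
        using tak_plus_int[of "2 * (q - p)" "-1"] by (simp add: algebra_simps)
      moreover have "tak p = p + tak (2 * p) / 2" using True Suc.prems by (intro tak_low) auto
      moreover have "tak q = 1 - q + tak (2 * q) / 2" using True Suc.prems by (intro tak_high) auto
      moreover have "tak (q - p) = 1 - (q - p) + tak (2 * (q - p)) / 2" using True Suc.prems by (intro tak_high) auto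
      ultimately show ?thesis by (simp add: tak_double_minus_1 min_def split: if_splits)
    next
      case False
      have rec2: "tak x = dist_int x + dist_int (2 * x) / 2 + tak (4 * x) / 4" for x
        using tak_rec[of x] tak_rec[of "2 * x"] by simp
      have sub: "tak (4 * (q - p)) \<le> tak (4 * q) + tak (4 * p)"
        using tak_diff[of "4 * q" "4 * p"] by (simp add: algebra_simps)
      have sub2: "dist_int (2 * (q - p)) \<le> dist_int (2 * q) + dist_int (2 * p)"
        using dist_int_subadd[of "2 * q" "- (2 * p)"] by (simp add: dist_int_minus algebra_simps)
      have dqp: "dist_int (q - p) = q - p" using False Suc.prems by (intro dist_int_low) auto
      have pos: "0 \<le> 2 / (2 ^ Suc m :: real)" by simp
      consider "q \<le> 1/2" | "p \<ge> 1/2" | "p < 1/2" "q > 1/2" by linarith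
      then have "min p (1 - q) \<le> dist_int p + dist_int q - dist_int (q - p)
          + (dist_int (2 * p) + dist_int (2 * q) - dist_int (2 * (q - p))) / 2"
      proof cases
        case 1
        then have "dist_int p = p" "dist_int q = q" using Suc.prems dist_int_low[of p] dist_int_low[of q] by auto
        then show ?thesis using sub2 dqp Suc.prems min.cobounded1[of p "1 - q"] min.cobounded2[of p "1 - q"] by argo
      next
        case 2
        then have "dist_int p = 1 - p" "dist_int q = 1 - q" using Suc.prems dist_int_high[of p] dist_int_high[of q] by auto
        then show ?thesis using sub2 dqp Suc.prems min.cobounded1[of p "1 - q"] min.cobounded2[of p "1 - q"] by argo
      next
        case 3
        have d2: "dist_int (2 * (q - p)) \<le> 1 - 2 * (q - p)"
          using dist_int_le[of "2 * (q - p)" 1] False by simp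
        have dp: "p \<le> 1/4 \<and> dist_int (2 * p) = 2 * p \<or> p > 1/4 \<and> dist_int (2 * p) = 1 - 2 * p"
          using 3 Suc.prems dist_int_low[of "2 * p"] dist_int_high[of "2 * p"] by (cases "p \<le> 1/4") auto
        have "dist_int (2 * q) = dist_int (2 * q - 1)" using dist_int_plus_int[of "2 * q" "-1"] by simp
        then have dq: "q \<le> 3/4 \<and> dist_int (2 * q) = 2 * q - 1 \<or> q > 3/4 \<and> dist_int (2 * q) = 2 - 2 * q"
          using 3 Suc.prems dist_int_low[of "2 * q - 1"] dist_int_high[of "2 * q - 1"] by (cases "q \<le> 3/4") auto
        have "dist_int p = p" "dist_int q = 1 - q"
          using 3 Suc.prems dist_int_low[of p] dist_int_high[of q] by auto
        then show ?thesis using d2 dp dq dqp 3 False Suc.prems min.cobounded1[of p "1 - q"] min.cobounded2[of p "1 - q"] by argo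
      qed
      then show ?thesis using rec2[of p] rec2[of q] rec2[of "q - p"] sub pos by argo
    qed
  qed
  show ?thesis
  proof (rule ccontr)
    assume "\<not> ?thesis"
    then have "0 < (min p (1 - q) - (tak p + tak q - tak (q - p))) / 2"
      by (simp only: not_le half_gt_zero_iff diff_gt_0_iff_gt)
    then obtain m where "(1/2) ^ m < (min p (1 - q) - (tak p + tak q - tak (q - p))) / 2"
      by (rule exE[OF real_arch_pow_inv[of _ "1/2"]]) auto
    then show False using *[OF assms, of m] by (simp only: power_one_over) argo
  qed
qed

text \<open>Apply \<open>tak_diff_strict\<close> with \<open>p = 2 * x - 1\<close> and
  \<open>q = 1 - 2 * y\<close>: by \<open>tgap_straddle\<close> and the symmetries of
  \<open>tak\<close>, its right-hand side is four times the gap.\<close>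

lemma tgap_straddle_low:
  assumes "0 \<le> y" "y \<le> 1/2" "1/2 \<le> x" "x \<le> 1" "x + y \<le> 1"
  shows "min (x - 1/2) y / 2 \<le> tgap x y"
proof -
  have "min (2 * x - 1) (1 - (1 - 2 * y)) \<le> tak (2 * x - 1) + tak (1 - 2 * y) - tak (1 - 2 * y - (2 * x - 1))"
    using assms by (intro tak_diff_strict) auto
  moreover have "tak (1 - 2 * y - (2 * x - 1)) = tak (2 * x + 2 * y)"
    using tak_plus_int[of "- (2 * x + 2 * y)" 2] tak_minus[of "2 * x + 2 * y"] by (simp add: algebra_simps)
  ultimately show ?thesis
    using tgap_straddle[of y x] assms by (auto simp: tak_double_minus_1 tak_reflect min_def split: if_splits)
qed

lemma tgap_straddle_high:
  assumes "0 \<le> y" "y \<le> 1/2" "1/2 \<le> x" "x \<le> 1" "1 \<le> x + y"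
  shows "min (1/2 - y) (1 - x) / 2 \<le> tgap x y"
  using tgap_straddle_low[of "1 - x" "1 - y"] assms
  by (simp add: tgap_reflect tgap_commute)

section \<open>The function x log x and its comparison with the Takagi function\<close>

definition xlog :: "real \<Rightarrow> real" where
  "xlog x = x * log 2 x"

lemma xlog_0 [simp]: "xlog 0 = 0" and xlog_1 [simp]: "xlog 1 = 0"
  by (simp_all add: xlog_def)

text \<open>Convexity in tangent form, from ln u \<le> u - 1 at u = c / a.\<close>

lemma xlog_tangent:
  assumes "0 \<le> a" "0 < c"
  shows "xlog c + (log 2 c + 1 / ln 2) * (a - c) \<le> xlog a"
proof (cases "a = 0")
  case True
  then show ?thesis using assms by (simp add: xlog_def algebra_simps)
next
  case False
  then have a: "0 < a" using assms by simp
  have "ln (c / a) \<le> c / a - 1" using a assms by (intro ln_le_minus_one) simp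
  then have "a * (ln c - ln a) \<le> c - a" using a assms by (simp add: ln_div field_simps)
  then have "a * ln c + (a - c) \<le> a * ln a" by (simp add: algebra_simps)
  then have "(a * ln c + (a - c)) / ln 2 \<le> a * ln a / ln 2" by (intro divide_right_mono) auto
  then show ?thesis by (simp add: xlog_def log_def field_simps)
qed

lemma xlog_convex:
  assumes "0 \<le> a" "0 \<le> b" "0 \<le> t" "t \<le> 1"
  shows "xlog ((1 - t) * a + t * b) \<le> (1 - t) * xlog a + t * xlog b"
proof (cases "(1 - t) * a + t * b = 0")
  case True
  then have "(1 - t) * a = 0" "t * b = 0" using assms
    by (smt (verit) mult_nonneg_nonneg)+
  then show ?thesis using True by (auto simp: xlog_def)
next
  case False
  define c where "c = (1 - t) * a + t * b"
  define s where "s = log 2 c + 1 / ln 2"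
  have "0 < c" using False assms unfolding c_def by (smt (verit) mult_nonneg_nonneg)
  then have "(1 - t) * (xlog c + s * (a - c)) + t * (xlog c + s * (b - c)) \<le> (1 - t) * xlog a + t * xlog b"
    using xlog_tangent[of a c] xlog_tangent[of b c] assms unfolding s_def
    by (intro add_mono mult_left_mono) auto
  moreover have "(1 - t) * (xlog c + s * (a - c)) + t * (xlog c + s * (b - c)) = xlog c + s * (((1 - t) * a + t * b) - c)"
    by (simp add: algebra_simps)
  ultimately show ?thesis unfolding c_def by simp
qed

lemma log2_3_le: "log 2 3 \<le> (8/5 :: real)"
proof -
  \<comment> \<open>Uses 3^5 = 243 < 256 = 2^8.\<close>
  have "5 * log 2 3 = log 2 (3 ^ 5 :: real)" by (subst log_nat_power) auto
  also have "\<dots> \<le> log 2 (2 ^ 8)" by (subst log_le_cancel_iff) auto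
  also have "\<dots> = 8" by (subst log_nat_power) auto
  finally show ?thesis by simp
qed

lemma xlog_mult: "0 < m \<Longrightarrow> 0 < a \<Longrightarrow> xlog (a * m) = a * (log 2 a * m + xlog m)"
  by (simp add: xlog_def log_mult algebra_simps)

text \<open>Concavity in \<open>y\<close> for a fixed mean \<open>m\<close>: the right-hand side vanishes at \<open>y = 0\<close> and \<open>y = m\<close>
  and is at least \<open>3 m / 10\<close> at \<open>y = m / 2\<close>.\<close>

lemma xlog_gap:
  assumes "0 \<le> y" "y \<le> x"
  shows "min y ((x - y) / 2) / 2 \<le> xlog ((x + y) / 2) + (x - y) / 2 - (xlog x + xlog y) / 2"
proof (cases "x + y = 0")
  case True
  then have "x = 0" "y = 0" using assms by auto
  then show ?thesis by simp
next
  case False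
  define m where "m = (x + y) / 2"
  have m: "0 < m" using False assms by (simp add: m_def)
  have l2: "xlog (2 * m) = 2 * m + 2 * xlog m" using xlog_mult[of m 2] m by simp
  have l12: "xlog (m / 2) = - (m / 2) + xlog m / 2"
    using xlog_mult[of m "1/2"] m by (simp add: log_divide field_simps)
  have "log 2 (3/2 :: real) \<le> 3/5" using log2_3_le by (simp add: log_divide)
  then have l32: "xlog (3/2 * m) \<le> 3/2 * (3/5 * m + xlog m)"
    using xlog_mult[of m "3/2"] m by (simp add: mult_right_mono)
  have x: "x = 2 * m - y" by (simp add: m_def field_simps)
  show ?thesis
  proof (cases "y \<le> m / 2")
    case True
    \<comment> \<open>As \<open>t\<close> runs from 0 to 1, \<open>y\<close> moves from 0 to
      \<open>m / 2\<close> and \<open>x\<close> from \<open>2 * m\<close> to \<open>3/2 * m\<close>;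
      convexity bounds both terms by chords.\<close>
    define t where "t = 2 * y / m"
    have t: "0 \<le> t" "t \<le> 1" using True assms m by (auto simp: t_def field_simps)
    have ty: "t * m = 2 * y" using m by (simp add: t_def)
    have "(1 - t) * 0 + t * (m / 2) = y" "(1 - t) * (2 * m) + t * (3/2 * m) = x"
      using ty x by (auto simp: algebra_simps)
    then have "xlog y \<le> t * xlog (m / 2)" "xlog x \<le> (1 - t) * xlog (2 * m) + t * xlog (3/2 * m)"
      using xlog_convex[of 0 "m / 2" t] xlog_convex[of "2 * m" "3/2 * m" t] t m by auto
    moreover have "t * xlog (3/2 * m) \<le> t * (3/2 * (3/5 * m + xlog m))" using t l32 by (intro mult_left_mono) auto
    ultimately have "xlog x + xlog y \<le> t * (- (m / 2) + xlog m / 2) + (1 - t) * (2 * m + 2 * xlog m) + t * (3/2 * (3/5 * m + xlog m))"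
      unfolding l12 l2 by linarith
    also have "\<dots> = 2 * m + 2 * xlog m - 8/5 * (t * m)" by (simp add: algebra_simps)
    finally have "xlog x + xlog y \<le> 2 * m + 2 * xlog m - 16/5 * y" unfolding ty by simp
    moreover have "min y ((x - y) / 2) \<le> y" by simp
    ultimately show ?thesis using x assms unfolding m_def[symmetric] by argo
  next
    case False
    \<comment> \<open>Here \<open>t = 0\<close> is the point \<open>x = y = m\<close>, and
      \<open>t = 1\<close> is again \<open>y = m / 2\<close>.\<close>
    define t where "t = 2 * (m - y) / m"
    have t: "0 \<le> t" "t \<le> 1" using False assms m by (auto simp: t_def x field_simps)
    have ty: "t * m = 2 * m - 2 * y" using m by (simp add: t_def)
    have "(1 - t) * m + t * (m / 2) = y" "(1 - t) * m + t * (3/2 * m) = x"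
      using ty x by (auto simp: algebra_simps)
    then have "xlog y \<le> (1 - t) * xlog m + t * xlog (m / 2)" "xlog x \<le> (1 - t) * xlog m + t * xlog (3/2 * m)"
      using xlog_convex[of m "m / 2" t] xlog_convex[of m "3/2 * m" t] t m by auto
    moreover have "t * xlog (3/2 * m) \<le> t * (3/2 * (3/5 * m + xlog m))" using t l32 by (intro mult_left_mono) auto
    ultimately have "xlog x + xlog y \<le> (1 - t) * xlog m + t * (- (m / 2) + xlog m / 2) + (1 - t) * xlog m + t * (3/2 * (3/5 * m + xlog m))"
      unfolding l12 by linarith
    also have "\<dots> = 2 * xlog m + 2/5 * (t * m)" by (simp add: algebra_simps)
    finally have "xlog x + xlog y \<le> 2 * xlog m + 4/5 * (m - y)" unfolding ty by simp
    moreover have "min y ((x - y) / 2) \<le> (x - y) / 2" by (rule min.cobounded2)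
    ultimately show ?thesis using x assms unfolding m_def[symmetric] by argo
  qed
qed

text \<open>The slack between the sharp bound \<open>tak\<close> and the entropy bound
  \<open>- xlog\<close>: boundary plus \<open>xlog\<close> equals deficit plus
  \<open>takw\<close>.\<close>

definition takw :: "real \<Rightarrow> real" where
  "takw x = tak x + xlog x"

lemma takw_scale:
  assumes "0 < x" "2 ^ k * x \<le> 1"
  shows "takw (2 ^ k * x) = 2 ^ k * takw x"
proof -
  have "tak x = (tak (2 ^ k * x) + k * (2 ^ k * x)) / 2 ^ k"
    using tak_scale[of "2 ^ k * x" k] assms by simp
  moreover have "xlog (2 ^ k * x) = 2 ^ k * (k * x + xlog x)"
    using xlog_mult[of x "2 ^ k"] assms by (simp add: log_nat_power)
  ultimately show ?thesis by (simp add: takw_def field_simps)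
qed

text \<open>The two bounds agree at 1/2. Above 1/2 the estimate
  \<open>log 2 (1 + q) \<le> 2 * q\<close> follows from \<open>1/2 \<le> ln 2\<close>; below 1/2 it
  is enough that \<open>log 2 x \<le> -1\<close>.\<close>

lemma takw_near_half:
  assumes "\<bar>2 * x - 1\<bar> \<le> 1/5"
  shows "takw x \<le> tak \<bar>2 * x - 1\<bar> / 2 + 2 * \<bar>2 * x - 1\<bar>"
proof (cases "x \<ge> 1/2")
  case True
  define q where "q = 2 * x - 1"
  have q: "0 \<le> q" "q \<le> 1/5" "x = (1 + q) / 2" using True assms by (auto simp: q_def)
  have "ln (1 + q) \<le> q" using q by (intro ln_add_one_self_le_self)
  moreover have "1/2 \<le> ln (2::real)" using ln_le_minus_one[of "1/2"] by (simp add: ln_div)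
  moreover have "q * (1/2) \<le> q * ln 2" using q \<open>1/2 \<le> ln 2\<close> by (intro mult_left_mono) auto
  ultimately have "log 2 (1 + q) \<le> 2 * q" unfolding log_def by (simp add: field_simps)
  moreover have "log 2 x = log 2 (1 + q) - 1" using q(1,2) by (subst q(3)) (simp add: log_divide)
  ultimately have "log 2 x \<le> 2 * q - 1" by linarith
  then have A: "x * log 2 x \<le> x * (2 * q - 1)" using True by (intro mult_left_mono) auto
  have B: "x * (2 * q - 1) = 2 * (x * q) - x" by (simp add: algebra_simps)
  have C: "x * q \<le> 1 * q" using q(1,2) True assms by (intro mult_right_mono) auto
  have D: "tak x = 1 - x + tak q / 2"
    using tak_high[of x] True assms tak_double_minus_1[of x] unfolding q_def by simp
  have E: "1 - 2 * x \<le> 0" using True by simp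
  have "takw x \<le> tak q / 2 + 2 * q" unfolding takw_def xlog_def D using A B C E by argo
  then show ?thesis using q(1) by (simp add: q_def)
next
  case False
  define q where "q = 1 - 2 * x"
  have q: "0 \<le> q" "q \<le> 1/5" "x = (1 - q) / 2" using False assms by (auto simp: q_def)
  have "log 2 (1 - q) \<le> 0" using q by (simp add: log_le_zero_cancel_iff)
  moreover have "log 2 x = log 2 (1 - q) - 1" using q(1,2) by (subst q(3)) (simp add: log_divide)
  ultimately have "log 2 x \<le> - 1" by linarith
  moreover have "0 \<le> x" using assms by (simp add: abs_if split: if_splits)
  ultimately have "x * log 2 x \<le> x * (- 1)" by (rule mult_left_mono)
  moreover have "tak x = x + tak q / 2"
    using tak_low[of x] q(1,2) tak_reflect[of "2 * x"] unfolding q_def by simp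
  ultimately have "takw x \<le> tak q / 2" unfolding takw_def xlog_def by simp
  then show ?thesis using q(1) by (simp add: q_def abs_minus_commute)
qed

section \<open>Families of sets and their halves\<close>

text \<open>Coordinate \<open>i\<close> is removed from the sets of either half, so that both halves
  are families on the same ground set \<open>V - {i}\<close> and can be compared there.\<close>

definition half :: "'a \<Rightarrow> bool \<Rightarrow> 'a set set \<Rightarrow> 'a set set" where
  "half i b F = {S. i \<notin> S \<and> (if b then insert i S else S) \<in> F}"

definition glue :: "'a \<Rightarrow> bool \<Rightarrow> 'a set set \<Rightarrow> 'a set set \<Rightarrow> 'a set set" where
  "glue i b X Y = {S. S - {i} \<in> (if (i \<in> S) = b then X else Y)}"

definition meas :: "'a set \<Rightarrow> 'a set set \<Rightarrow> real" where
  "meas V F = card F / 2 ^ card V"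

text \<open>The edge boundary divided by \<open>2 ^ card V\<close>: edges in direction
  \<open>i\<close> correspond to the sets on which the two halves differ, and the factor 1/2
  reflects that those sets live in a cube half as large.\<close>

definition bdry :: "'a set \<Rightarrow> 'a set set \<Rightarrow> real" where
  "bdry V F = (\<Sum>i\<in>V. meas (V - {i}) (sym_diff (half i True F) (half i False F))) / 2"

definition deficit :: "'a set \<Rightarrow> 'a set set \<Rightarrow> real" where
  "deficit V F = bdry V F - tak (meas V F)"

lemma half_subset: "F \<subseteq> Pow V \<Longrightarrow> half i b F \<subseteq> Pow (V - {i})"
  by (auto simp: half_def split: if_splits)

lemma half_sym_diff: "half i b (sym_diff F G) = sym_diff (half i b F) (half i b G)"
  by (auto simp: half_def)

lemma half_commute: "i \<noteq> j \<Longrightarrow> half i b (half j c F) = half j c (half i b F)"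
  by (auto simp: half_def insert_commute)

lemma half_glue:
  assumes "X \<subseteq> Pow (V - {i})" "Y \<subseteq> Pow (V - {i})"
  shows "half i b (glue i b X Y) = X" "half i (\<not> b) (glue i b X Y) = Y"
proof -
  have "x - {i} = x" if "x \<in> X \<union> Y" for x using assms that by auto
  then show "half i b (glue i b X Y) = X" "half i (\<not> b) (glue i b X Y) = Y"
    using assms by (auto simp: half_def glue_def)
qed

lemma glue_subset: "i \<in> V \<Longrightarrow> X \<subseteq> Pow (V - {i}) \<Longrightarrow> Y \<subseteq> Pow (V - {i}) \<Longrightarrow> glue i b X Y \<subseteq> Pow V"
  by (auto simp: glue_def split: if_splits)

lemma card_half:
  assumes "finite V" "F \<subseteq> Pow V"
  shows "card F = card (half i b F) + card (half i (\<not> b) F)"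
proof -
  have eq: "F = insert i ` half i True F \<union> half i False F"
  proof (intro equalityI subsetI)
    fix S assume "S \<in> F"
    then show "S \<in> insert i ` half i True F \<union> half i False F"
      by (cases "i \<in> S") (auto simp: half_def insert_absorb intro!: image_eqI[of S "insert i" "S - {i}"])
  qed (auto simp: half_def)
  have fin: "finite (half i b F)" for b
    using half_subset[OF assms(2)] assms(1) by (meson finite_Diff finite_Pow_iff finite_subset)
  have "card F = card (insert i ` half i True F) + card (half i False F)"
  proof (subst eq, rule card_Un_disjoint)
    show "insert i ` half i True F \<inter> half i False F = {}" by (auto simp: half_def)
  qed (use fin in auto)
  also have "card (insert i ` half i True F) = card (half i True F)"
    by (intro card_image inj_onI) (auto simp: half_def)
  finally show ?thesis by (cases b) auto
qed

lemma meas_half: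
  assumes "finite V" "F \<subseteq> Pow V" "i \<in> V"
  shows "meas V F = (meas (V - {i}) (half i b F) + meas (V - {i}) (half i (\<not> b) F)) / 2"
proof -
  have "card V = Suc (card (V - {i}))" using assms by (metis card_Suc_Diff1)
  then show ?thesis unfolding meas_def using card_half[OF assms(1,2), of i b]
    by (simp add: field_simps)
qed

lemma finite_family: "finite V \<Longrightarrow> F \<subseteq> Pow V \<Longrightarrow> finite F"
  by (meson finite_Pow_iff finite_subset)

lemma meas_nonneg [simp]: "0 \<le> meas V F"
  by (simp add: meas_def)

lemma meas_empty [simp]: "meas V {} = 0"
  by (simp add: meas_def)

lemma meas_Pow: "finite V \<Longrightarrow> meas V (Pow V) = 1"
  by (simp add: meas_def card_Pow)

lemma meas_mono: "finite V \<Longrightarrow> B \<subseteq> Pow V \<Longrightarrow> A \<subseteq> B \<Longrightarrow> meas V A \<le> meas V B"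
  unfolding meas_def by (intro divide_right_mono) (auto intro: card_mono finite_family)

lemma meas_le_1: "finite V \<Longrightarrow> F \<subseteq> Pow V \<Longrightarrow> meas V F \<le> 1"
  using meas_mono[of V "Pow V" F] by (simp add: meas_Pow)

lemma meas_Un_le: "meas V (A \<union> B) \<le> meas V A + meas V B"
proof -
  have "real (card (A \<union> B)) \<le> real (card A + card B)" by (simp only: of_nat_le_iff card_Un_le)
  then show ?thesis unfolding meas_def by (simp flip: add_divide_distrib add: divide_right_mono)
qed

lemma meas_Diff:
  assumes "finite V" "A \<subseteq> Pow V" "B \<subseteq> Pow V"
  shows "meas V A = meas V B + meas V (A - B) - meas V (B - A)"
proof -
  have fin: "finite A" "finite B" using assms by (auto intro: finite_family)
  have "card A = card (A - B) + card (A \<inter> B)" "card B = card (B - A) + card (A \<inter> B)"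
    using card_Int_Diff[OF fin(1), of B] card_Int_Diff[OF fin(2), of A] by (auto simp: Int_commute)
  then show ?thesis by (simp add: meas_def field_simps)
qed

lemma meas_sym_diff:
  assumes "finite V" "A \<subseteq> Pow V" "B \<subseteq> Pow V"
  shows "meas V (sym_diff A B) = meas V (A - B) + meas V (B - A)"
proof -
  have fin: "finite A" "finite B" using assms by (auto intro: finite_family)
  then have "card (sym_diff A B) = card (A - B) + card (B - A)"
    by (intro card_Un_disjoint) auto
  then show ?thesis by (simp add: meas_def add_divide_distrib)
qed

lemma meas_sym_diff_eq:
  assumes "finite V" "A \<subseteq> Pow V" "B \<subseteq> Pow V"
  shows "meas V (sym_diff A B) = meas V A - meas V B + 2 * meas V (B - A)"
  using meas_Diff[OF assms] meas_sym_diff[OF assms] by simp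

lemma meas_dist_triangle:
  assumes "finite V" "A \<subseteq> Pow V" "B \<subseteq> Pow V" "C \<subseteq> Pow V"
  shows "meas V (sym_diff A C) \<le> meas V (sym_diff A B) + meas V (sym_diff B C)"
proof -
  have "meas V (sym_diff A C) \<le> meas V (sym_diff A B \<union> sym_diff B C)"
    by (intro meas_mono) (use assms in auto)
  also have "\<dots> \<le> meas V (sym_diff A B) + meas V (sym_diff B C)" by (rule meas_Un_le)
  finally show ?thesis .
qed

lemma abs_meas_diff_le:
  assumes "finite V" "A \<subseteq> Pow V" "B \<subseteq> Pow V"
  shows "\<bar>meas V A - meas V B\<bar> \<le> meas V (sym_diff A B)"
  using meas_Diff[OF assms] meas_sym_diff[OF assms] meas_nonneg[of V "A - B"] meas_nonneg[of V "B - A"]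
  by linarith

lemma bdry_half:
  assumes "finite V" "F \<subseteq> Pow V" "i \<in> V"
  shows "bdry V F = (bdry (V - {i}) (half i b F) + bdry (V - {i}) (half i (\<not> b) F)) / 2
    + meas (V - {i}) (sym_diff (half i b F) (half i (\<not> b) F)) / 2"
proof -
  let ?W = "V - {i}"
  let ?D = "\<lambda>G j. sym_diff (half j True G) (half j False G)"
  have dir: "meas (V - {j}) (?D F j)
      = (meas (?W - {j}) (?D (half i b F) j) + meas (?W - {j}) (?D (half i (\<not> b) F) j)) / 2"
    if "j \<in> ?W" for j
  proof -
    have "?D F j \<subseteq> Pow (V - {j})" using half_subset[OF assms(2)] by blast
    moreover have "half i c (?D F j) = ?D (half i c F) j" for c
      using half_commute[of i j] that by (auto simp: half_sym_diff)
    moreover have "V - {j} - {i} = ?W - {j}" by auto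
    ultimately show ?thesis using meas_half[of "V - {j}" "?D F j" i b] assms that by auto
  qed
  have "2 * bdry V F = meas ?W (?D F i) + (\<Sum>j\<in>?W. meas (V - {j}) (?D F j))"
    unfolding bdry_def by (simp add: sum.remove[OF assms(1,3)])
  also have "(\<Sum>j\<in>?W. meas (V - {j}) (?D F j)) = bdry ?W (half i b F) + bdry ?W (half i (\<not> b) F)"
  proof -
    have "(\<Sum>j\<in>?W. meas (V - {j}) (?D F j)) = (\<Sum>j\<in>?W. (meas (?W - {j}) (?D (half i b F) j) + meas (?W - {j}) (?D (half i (\<not> b) F) j)) / 2)"
      by (rule sum.cong[OF refl dir])
    then show ?thesis by (simp only: bdry_def sum.distrib add_divide_distrib sum_divide_distrib)
  qed
  also have "meas ?W (?D F i) = meas ?W (sym_diff (half i b F) (half i (\<not> b) F))"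
    by (cases b) (auto simp: Un_commute)
  finally show ?thesis by argo
qed

lemma deficit_half:
  assumes "finite V" "F \<subseteq> Pow V" "i \<in> V"
  shows "deficit V F = (deficit (V - {i}) (half i b F) + deficit (V - {i}) (half i (\<not> b) F)) / 2
    + tgap (meas (V - {i}) (half i b F)) (meas (V - {i}) (half i (\<not> b) F))
    + (meas (V - {i}) (sym_diff (half i b F) (half i (\<not> b) F))
       - \<bar>meas (V - {i}) (half i b F) - meas (V - {i}) (half i (\<not> b) F)\<bar>) / 2"
  unfolding deficit_def tgap_def bdry_half[OF assms, of b] meas_half[OF assms, of b]
  by (simp add: field_simps)

lemma family_on_empty: "F \<subseteq> Pow {} \<Longrightarrow> F = {} \<or> F = {{}}"
  by auto

text \<open>The edge-isoperimetric inequality: in \<open>deficit_half\<close> the deficits of the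
  halves, the gap and the excess of the symmetric difference are all nonnegative.\<close>

lemma deficit_nonneg: "finite V \<Longrightarrow> F \<subseteq> Pow V \<Longrightarrow> 0 \<le> deficit V F"
proof (induction V arbitrary: F rule: finite_induct)
  case empty
  then show ?case using family_on_empty[of F] by (auto simp: deficit_def bdry_def meas_def)
next
  case (insert i W)
  let ?V = "insert i W"
  have W: "?V - {i} = W" using insert by auto
  have sub: "half i b F \<subseteq> Pow W" for b using half_subset[OF insert.prems, of i b] W by simp
  have "0 \<le> tgap (meas W (half i True F)) (meas W (half i False F))"
    using meas_le_1[OF insert.hyps(1) sub] by (intro tgap_nonneg) auto
  then show ?case
    using deficit_half[of ?V F i True] insert.IH[OF sub, of True] insert.IH[OF sub, of False]
      abs_meas_diff_le[OF insert.hyps(1) sub sub, of True False] insert W by simp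
qed

section \<open>Subcubes and stability for the entropy bound\<close>

definition subcube :: "'a set \<Rightarrow> 'a set set \<Rightarrow> bool" where
  "subcube V K \<longleftrightarrow> K = {} \<or> (\<exists>B U. B \<subseteq> U \<and> U \<subseteq> V \<and> K = {S. B \<subseteq> S \<and> S \<subseteq> U})"

lemma subcubeI: "B \<subseteq> U \<Longrightarrow> U \<subseteq> V \<Longrightarrow> K = {S. B \<subseteq> S \<and> S \<subseteq> U} \<Longrightarrow> subcube V K"
  unfolding subcube_def by blast

lemma subcube_subset: "subcube V K \<Longrightarrow> K \<subseteq> Pow V"
  by (auto simp: subcube_def)

lemma subcube_glue_empty:
  assumes "subcube (V - {i}) K" "i \<in> V"
  shows "subcube V (glue i b K {})"
proof (cases "K = {}")
  case True
  then show ?thesis by (auto simp: subcube_def glue_def)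
next
  case False
  then obtain B U where BU: "B \<subseteq> U" "U \<subseteq> V - {i}" and K: "K = {S. B \<subseteq> S \<and> S \<subseteq> U}"
    using assms by (auto simp: subcube_def)
  show ?thesis
  proof (cases b)
    case True
    have "glue i b K {} = {S. insert i B \<subseteq> S \<and> S \<subseteq> insert i U}"
      using True BU by (auto simp: glue_def K)
    moreover have "insert i B \<subseteq> insert i U" "insert i U \<subseteq> V" using BU assms(2) by auto
    ultimately show ?thesis by (intro subcubeI[of "insert i B" "insert i U"])
  next
    case False
    have "glue i b K {} = {S. B \<subseteq> S \<and> S \<subseteq> U}"
      using False BU by (auto simp: glue_def K split: if_splits)
    moreover have "U \<subseteq> V" using BU by auto
    ultimately show ?thesis using BU(1) by (intro subcubeI[of B U])
  qed
qed

lemma subcube_glue_same: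
  assumes "subcube (V - {i}) K" "i \<in> V"
  shows "subcube V (glue i b K K)"
proof (cases "K = {}")
  case True
  then show ?thesis by (auto simp: subcube_def glue_def)
next
  case False
  then obtain B U where BU: "B \<subseteq> U" "U \<subseteq> V - {i}" and K: "K = {S. B \<subseteq> S \<and> S \<subseteq> U}"
    using assms by (auto simp: subcube_def)
  have "glue i b K K = {S. B \<subseteq> S \<and> S \<subseteq> insert i U}"
    using BU by (auto simp: glue_def K)
  moreover have "B \<subseteq> insert i U" "insert i U \<subseteq> V" using BU assms(2) by auto
  ultimately show ?thesis by (intro subcubeI[of B "insert i U"])
qed

text \<open>An interval [B, U] other than the whole cube has a coordinate in B or outside U, and
  membership of that coordinate is constant on it.\<close>

lemma subcube_fixed_coordinate:
  assumes "subcube V K" "K \<noteq> {}" "K \<noteq> Pow V"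
  obtains j b where "j \<in> V" "half j b K = {}"
proof -
  obtain B U where BU: "B \<subseteq> U" "U \<subseteq> V" and K: "K = {S. B \<subseteq> S \<and> S \<subseteq> U}"
    using assms by (auto simp: subcube_def)
  have "B \<noteq> {} \<or> U \<noteq> V" using assms(3) by (auto simp: K)
  then consider j where "j \<in> B" | j where "j \<in> V" "j \<notin> U" using BU by auto
  then show thesis
  proof cases
    case 1
    then have "j \<in> V" "half j False K = {}" using BU by (auto simp: half_def K)
    then show ?thesis by (rule that)
  next
    case 2
    then have "j \<in> V" "half j True K = {}" by (auto simp: half_def K)
    then show ?thesis by (rule that)
  qed
qed

lemma meas_dist_glue:
  assumes "finite V" "i \<in> V" "F \<subseteq> Pow V" "X \<subseteq> Pow (V - {i})" "Y \<subseteq> Pow (V - {i})"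
  shows "meas V (sym_diff F (glue i b X Y))
    = (meas (V - {i}) (sym_diff (half i b F) X) + meas (V - {i}) (sym_diff (half i (\<not> b) F) Y)) / 2"
proof -
  have "sym_diff F (glue i b X Y) \<subseteq> Pow V" using assms glue_subset[of i V X Y b] by blast
  then show ?thesis
    using meas_half[of V _ i b] assms by (simp add: half_sym_diff half_glue[of X V i Y])
qed

text \<open>Induction on the coordinates. The gap of \<open>xlog\<close> pays either for discarding
  a much lighter half or, when the densities are comparable, for approximating both halves by the
  same subcube.\<close>

theorem subcube_stability:
  assumes "finite V" "F \<subseteq> Pow V"
  shows "\<exists>K. subcube V K \<and> meas V (sym_diff F K) \<le> 2 * (bdry V F + xlog (meas V F))"
  using assms
proof (induction V arbitrary: F rule: finite_induct)
  case empty
  \<comment> \<open>The empty family counts as a subcube, so on the empty ground set every family is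
    one.\<close>
  have "subcube {} {}" "subcube {} {{}}" by (auto simp: subcube_def)
  then show ?case using family_on_empty[OF empty] by (intro exI[of _ F]) (auto simp: bdry_def meas_def)
next
  case (insert i W)
  let ?V = "insert i W"
  have W: "?V - {i} = W" and V: "finite ?V" "i \<in> ?V" using insert by auto
  have sub: "half i b F \<subseteq> Pow W" for b using half_subset[OF insert.prems, of i b] W by simp
  define e where "e b = bdry W (half i b F) + xlog (meas W (half i b F))" for b
  obtain b where b: "meas W (half i (\<not> b) F) \<le> meas W (half i b F)"
    by (cases "meas W (half i True F) \<le> meas W (half i False F)") (force intro: that[of False] that[of True])+
  define x y where "x = meas W (half i b F)" and "y = meas W (half i (\<not> b) F)"
  define z where "z = meas W (sym_diff (half i b F) (half i (\<not> b) F))"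
  have xy: "0 \<le> y" "y \<le> x" using b by (auto simp: x_def y_def)
  have z: "x - y \<le> z" using abs_meas_diff_le[OF insert.hyps(1) sub sub, of b "\<not> b"]
    by (simp add: x_def y_def z_def)
  have split: "bdry ?V F + xlog (meas ?V F)
      = (e b + e (\<not> b)) / 2 + (xlog ((x + y) / 2) + (x - y) / 2 - (xlog x + xlog y) / 2) + (z - (x - y)) / 2"
  proof -
    have m: "meas ?V F = (x + y) / 2" using meas_half[OF V(1) insert.prems V(2), of b] W by (simp add: x_def y_def)
    have bd: "bdry ?V F = (bdry W (half i b F) + bdry W (half i (\<not> b) F)) / 2 + z / 2"
      using bdry_half[OF V(1) insert.prems V(2), of b] W by (simp add: z_def)
    show ?thesis unfolding m bd e_def x_def[symmetric] y_def[symmetric] by argo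
  qed
  have gap: "min y ((x - y) / 2) / 2 \<le> xlog ((x + y) / 2) + (x - y) / 2 - (xlog x + xlog y) / 2"
    using xlog_gap[OF xy] .
  have IH: "\<exists>K. subcube W K \<and> meas W (sym_diff (half i c F) K) \<le> 2 * e c" for c
    using insert.IH[OF sub[of c]] by (simp add: e_def)
  have e0: "0 \<le> e c" for c using IH[of c] meas_nonneg by (smt (verit))
  show ?case
  proof (cases "y \<le> (x - y) / 2")
    case True
    obtain K where K: "subcube W K" "meas W (sym_diff (half i b F) K) \<le> 2 * e b" using IH by blast
    have "meas ?V (sym_diff F (glue i b K {})) = (meas W (sym_diff (half i b F) K) + y) / 2"
      using meas_dist_glue[OF V insert.prems, of K "{}" b] W subcube_subset[OF K(1)] by (simp add: y_def)
    also have "\<dots> \<le> 2 * (bdry ?V F + xlog (meas ?V F))"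
    proof -
      have "y / 2 \<le> xlog ((x + y) / 2) + (x - y) / 2 - (xlog x + xlog y) / 2"
        using gap True by (simp only: min_absorb1)
      then show ?thesis unfolding split using K(2) e0[of "\<not> b"] z xy by argo
    qed
    finally show ?thesis using subcube_glue_empty[of ?V i K b] K(1) W by auto
  next
    case False
    \<comment> \<open>The half with the smaller excess supplies the subcube, whether or not it is
      the heavier one.\<close>
    obtain c where c: "e c \<le> e (\<not> c)" "\<not> c = b \<or> c = b" by (cases "e True \<le> e False") (force intro: that[of False] that[of True])+
    obtain K where K: "subcube W K" "meas W (sym_diff (half i c F) K) \<le> 2 * e c" using IH by blast
    have "meas W (sym_diff (half i (\<not> c) F) K)
        \<le> meas W (sym_diff (half i (\<not> c) F) (half i c F)) + meas W (sym_diff (half i c F) K)"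
      by (rule meas_dist_triangle) (use insert sub subcube_subset[OF K(1)] in auto)
    also have "meas W (sym_diff (half i (\<not> c) F) (half i c F)) = z"
      unfolding z_def using c(2) by (auto simp: Un_commute)
    finally have "meas ?V (sym_diff F (glue i c K K)) \<le> meas W (sym_diff (half i c F) K) + z / 2"
      using meas_dist_glue[OF V insert.prems, of K K c] W subcube_subset[OF K(1)] by simp
    also have "\<dots> \<le> 2 * (bdry ?V F + xlog (meas ?V F))"
    proof -
      have "e c + e (\<not> c) = e b + e (\<not> b)" using c(2) by auto
      \<comment> \<open>Twice this gap plus \<open>z - (x - y)\<close> is at least
        \<open>z / 2\<close>, the cost of using the same subcube on the other half.\<close>
      moreover have "(x - y) / 4 \<le> xlog ((x + y) / 2) + (x - y) / 2 - (xlog x + xlog y) / 2"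
        using gap False min_absorb2[of "(x - y) / 2" y] by argo
      ultimately show ?thesis unfolding split using K(2) c(1) z xy by argo
    qed
    finally show ?thesis using subcube_glue_same[of ?V i K c] K(1) W by auto
  qed
qed

section \<open>Light sides of nearly extremal families\<close>

text \<open>The factor \<open>2 ^ k\<close> moves a density near a power of two to one near 1/2.
  There the slack \<open>takw\<close> is small, so entropy stability loses little beyond the
  deficit.\<close>

lemma near_half_subcube:
  assumes "finite V" "F \<subseteq> Pow V" "q = \<bar>2 * (2 ^ k * meas V F) - 1\<bar>" "q \<le> 1/5"
  shows "\<exists>K. subcube V K \<and> 2 ^ k * meas V (sym_diff F K) \<le> 2 * (2 ^ k * deficit V F + tak q / 2 + 2 * q)"
proof -
  let ?M = "2 ^ k * meas V F"
  have M: "0 < ?M" "?M \<le> 1"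
    using assms(3,4) abs_ge_self[of "2 * ?M - 1"] abs_ge_minus_self[of "2 * ?M - 1"] by argo+
  then have "0 < meas V F" by (simp add: zero_less_mult_iff)
  then have "2 ^ k * takw (meas V F) = takw ?M" using takw_scale M by simp
  also have "\<dots> \<le> tak q / 2 + 2 * q" using takw_near_half assms(3,4) by simp
  finally have w: "2 ^ k * takw (meas V F) \<le> tak q / 2 + 2 * q" .
  obtain K where K: "subcube V K" "meas V (sym_diff F K) \<le> 2 * (bdry V F + xlog (meas V F))"
    using subcube_stability[OF assms(1,2)] by blast
  have "2 ^ k * meas V (sym_diff F K) \<le> 2 ^ k * (2 * (deficit V F + takw (meas V F)))"
    using K(2) by (intro mult_left_mono) (auto simp: deficit_def takw_def)
  also have "\<dots> = 2 * (2 ^ k * deficit V F + 2 ^ k * takw (meas V F))" by (simp add: algebra_simps)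
  also have "\<dots> \<le> 2 * (2 ^ k * deficit V F + tak q / 2 + 2 * q)" using w by simp
  finally show ?thesis using K(1) by blast
qed

lemma meas_half_le:
  assumes "finite V" "F \<subseteq> Pow V" "i \<in> V"
  shows "meas (V - {i}) (half i b F) \<le> 2 * meas V F"
  using meas_half[OF assms, of b] meas_nonneg[of "V - {i}" "half i (\<not> b) F"] by argo

text \<open>The nearby subcube is neither empty nor the whole cube, hence misses one side of some
  coordinate. That side of \<open>F\<close> lies in the symmetric difference of \<open>F\<close> and
  the subcube.\<close>

lemma near_half_light_side:
  assumes "finite V" "F \<subseteq> Pow V" "q = \<bar>2 * (2 ^ k * meas V F) - 1\<bar>" "q \<le> 1/5"
    and D: "2 * (2 ^ k * deficit V F + tak q / 2 + 2 * q) \<le> D" "D \<le> 1/4"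
  shows "\<exists>j\<in>V. \<exists>b. 2 ^ k * meas (V - {j}) (half j b F) \<le> 2 * D"
proof -
  obtain K where K: "subcube V K" "2 ^ k * meas V (sym_diff F K) \<le> D"
    using near_half_subcube[OF assms(1-4)] D(1) by force
  have KV: "K \<subseteq> Pow V" using subcube_subset[OF K(1)] .
  have "\<bar>2 ^ k * meas V F - 2 ^ k * meas V K\<bar> = 2 ^ k * \<bar>meas V F - meas V K\<bar>"
    by (simp add: abs_mult flip: right_diff_distrib)
  also have "\<dots> \<le> 2 ^ k * meas V (sym_diff F K)"
    using abs_meas_diff_le[OF assms(1,2) KV] by (intro mult_left_mono) auto
  finally have dK: "\<bar>2 ^ k * meas V F - 2 ^ k * meas V K\<bar> \<le> 1/4" using K(2) D(2) by linarith
  have M: "2/5 \<le> 2 ^ k * meas V F" "2 ^ k * meas V F \<le> 3/5"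
    using assms(3,4) abs_ge_self[of "2 * (2 ^ k * meas V F) - 1"] abs_ge_minus_self[of "2 * (2 ^ k * meas V F) - 1"] by argo+
  have "K \<noteq> {}" using dK M by auto
  moreover have "K \<noteq> Pow V"
  proof
    assume "K = Pow V"
    then have "meas V K = 1" using assms(1) by (simp add: meas_Pow)
    moreover have "(1::real) \<le> 2 ^ k" by simp
    ultimately have "2 ^ k * meas V K \<ge> 1" by simp
    then show False using dK M abs_ge_minus_self[of "2 ^ k * meas V F - 2 ^ k * meas V K"] by argo
  qed
  ultimately obtain j b where j: "j \<in> V" "half j b K = {}" using subcube_fixed_coordinate[OF K(1)] by metis
  have sub: "sym_diff F K \<subseteq> Pow V" using assms KV by blast
  have "half j b (sym_diff F K) = half j b F" using j(2) by (simp add: half_sym_diff)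
  then have "meas (V - {j}) (half j b F) \<le> 2 * meas V (sym_diff F K)"
    using meas_half_le[OF assms(1) sub j(1), of b] by simp
  then have "2 ^ k * meas (V - {j}) (half j b F) \<le> 2 ^ k * (2 * meas V (sym_diff F K))" by (intro mult_left_mono) auto
  also have "\<dots> \<le> 2 * D" using K(2) by simp
  finally show ?thesis using j(1) by blast
qed

text \<open>\<open>x \<le> 1\<close> keeps both scaled densities where the gap is self-similar. As
  side \<open>b\<close> is the heavier one, the excess of the symmetric difference becomes the part
  of the light half outside it.\<close>

lemma deficit_half_scaled:
  assumes "finite V" "F \<subseteq> Pow V" "i \<in> V"
    and "x = 2 ^ k * meas (V - {i}) (half i b F)" "y = 2 ^ k * meas (V - {i}) (half i (\<not> b) F)"
    and "y \<le> x" "x \<le> 1"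
  shows "2 ^ k * deficit V F = (2 ^ k * deficit (V - {i}) (half i b F) + 2 ^ k * deficit (V - {i}) (half i (\<not> b) F)) / 2
    + tgap x y + 2 ^ k * meas (V - {i}) (half i (\<not> b) F - half i b F)"
proof -
  let ?X = "half i b F" and ?Y = "half i (\<not> b) F" and ?W = "V - {i}"
  have sub: "?X \<subseteq> Pow ?W" "?Y \<subseteq> Pow ?W" using half_subset[OF assms(2)] by auto
  have le: "meas ?W ?Y \<le> meas ?W ?X" using assms(4-6) by simp
  have "tgap x y = 2 ^ k * tgap (meas ?W ?X) (meas ?W ?Y)"
    using order_trans[OF assms(6,7)] assms(7) unfolding assms(4,5) by (intro tgap_scale) auto
  moreover have "meas ?W (sym_diff ?X ?Y) - \<bar>meas ?W ?X - meas ?W ?Y\<bar> = 2 * meas ?W (?Y - ?X)"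
    using meas_sym_diff_eq[OF _ sub] le assms(1) by simp
  ultimately show ?thesis using deficit_half[OF assms(1-3), of b] by (simp add: algebra_simps)
qed

lemma deficit_half_le:
  assumes "finite V" "F \<subseteq> Pow V" "i \<in> V"
  shows "deficit (V - {i}) (half i b F) \<le> 2 * deficit V F"
proof -
  let ?W = "V - {i}"
  have fin: "finite ?W" and sub: "half i c F \<subseteq> Pow ?W" for c using half_subset[OF assms(2)] assms(1) by auto
  have "0 \<le> tgap (meas ?W (half i b F)) (meas ?W (half i (\<not> b) F))"
    using meas_le_1[OF fin sub] by (intro tgap_nonneg) auto
  then show ?thesis
    using deficit_half[OF assms, of b] deficit_nonneg[OF fin sub, of "\<not> b"]
      abs_meas_diff_le[OF fin sub sub, of b "\<not> b"] by argo
qed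

text \<open>Either the pair \<open>x\<close>, \<open>y\<close> or its double straddles 1/2, so the
  gap bounds a minimum of two terms. The term in \<open>y\<close> alone is too large, so the
  distance of \<open>x\<close> from 1/2 must be small.\<close>

lemma tight_light_side:
  assumes M: "1/4 \<le> (x + y) / 2" "(x + y) / 2 \<le> 1/4 + 1/2048" and y: "0 \<le> y" "y \<le> 1/32"
    and g: "tgap x y < y / 128"
  shows "\<bar>x - 1/2\<bar> \<le> y / 64"
proof (cases "x \<ge> 1/2")
  case True
  have "min (x - 1/2) y / 2 \<le> tgap x y" using True M y by (intro tgap_straddle_low) auto
  then show ?thesis using True g y unfolding min_def by (auto split: if_splits)
next
  case False
  have "min (1/2 - 2 * y) (1 - 2 * x) / 2 \<le> tgap (2 * x) (2 * y)"
    using False M y by (intro tgap_straddle_high) auto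
  also have "\<dots> = 2 * tgap x y" using False M y by (intro tgap_double) auto
  finally show ?thesis using False g y unfolding min_def by (auto split: if_splits)
qed

text \<open>Take the lightest side \<open>Y\<close> of all. If it costs too little, the opposite half \<open>X\<close> has almost exactly
  half of the scaled density, so \<open>X\<close> is close to a subcube with a further light side; by minimality
  that side is at least about as heavy as \<open>Y\<close>, and a family of density almost \<open>1/2\<close> pays for it.\<close>

lemma near_quarter:
  assumes fin: "finite V" and F: "F \<subseteq> Pow V"
    and M: "1/4 \<le> 2 ^ k * meas V F" "2 ^ k * meas V F \<le> 1/4 + 1/2048"
    and d: "2 ^ k * deficit V F \<le> 1/1024"
  shows "\<exists>j\<in>V. \<exists>b. meas (V - {j}) (half j (\<not> b) F) \<le> 128 * deficit V F \<and>
    (meas (V - {j}) (half j (\<not> b) F) \<le> 128 * (deficit V F - deficit (V - {j}) (half j b F) / 2)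
     \<or> (\<exists>K. subcube V K \<and> meas V (sym_diff F K) \<le> 14 * deficit V F))"
proof -
  \<comment> \<open>One scale up, the density is close to 1/2. This yields some side of scaled
    density at most 1/32, which bounds the lightest one.\<close>
  define q where "q = \<bar>2 * (2 ^ (k + 1) * meas V F) - 1\<bar>"
  have q: "0 \<le> q" "q \<le> 1 / 2 ^ 9" unfolding q_def using M by (simp_all add: abs_if)
  have "tak q \<le> 10 / 512" using tak_small[OF q] by simp
  then have "2 * (2 ^ (k + 1) * deficit V F + tak q / 2 + 2 * q) \<le> 1/32" using d q by simp
  then obtain j0 b0 where j0: "j0 \<in> V" "2 ^ (k + 1) * meas (V - {j0}) (half j0 b0 F) \<le> 2 * (1/32)"
    using near_half_light_side[OF fin F q_def, of "1/32"] q by auto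
  define f where "f = (\<lambda>(j, b). meas (V - {j}) (half j (\<not> b) F))"
  have "finite (V \<times> (UNIV :: bool set))" "V \<times> (UNIV :: bool set) \<noteq> {}" using fin j0 by auto
  then obtain jb where jb: "jb \<in> V \<times> UNIV" and min: "\<And>p. p \<in> V \<times> UNIV \<Longrightarrow> f jb \<le> f p"
    using arg_min_if_finite(1)[of "V \<times> UNIV" f] arg_min_least[of "V \<times> UNIV" _ f] by metis
  obtain j b where jb_eq: "jb = (j, b)" by (cases jb)
  have j: "j \<in> V" using jb jb_eq by auto
  have minimal: "meas (V - {j}) (half j (\<not> b) F) \<le> meas (V - {i}) (half i c F)" if "i \<in> V" for i c
    using min[of "(i, \<not> c)"] that by (simp add: f_def jb_eq)
  define W X Y where "W = V - {j}" and "X = half j b F" and "Y = half j (\<not> b) F"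
  have W: "finite W" "X \<subseteq> Pow W" "Y \<subseteq> Pow W" using fin half_subset[OF F] by (auto simp: W_def X_def Y_def)
  define x y where "x = 2 ^ k * meas W X" and "y = 2 ^ k * meas W Y"
  have "meas W Y \<le> meas (V - {j0}) (half j0 b0 F)" using minimal[OF j0(1)] by (simp add: W_def Y_def)
  then have "2 ^ (k + 1) * meas W Y \<le> 2 * (1/32)"
    using j0(2) mult_left_mono[of "meas W Y" _ "2 ^ (k + 1)"] by (smt (verit) zero_le_power)
  then have y: "0 \<le> y" "y \<le> 1/32" by (simp_all add: y_def)
  have "meas V F = (meas W X + meas W Y) / 2" using meas_half[OF fin F j, of b] by (simp add: W_def X_def Y_def)
  then have xy: "2 ^ k * meas V F = (x + y) / 2" by (simp only: x_def y_def distrib_left times_divide_eq_right)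
  have x: "7/16 \<le> x" "x \<le> 1" using xy M y by auto
  define dF dX where "dF = 2 ^ k * deficit V F" and "dX = 2 ^ k * deficit W X"
  have dX: "0 \<le> dX" "dX \<le> 2 * dF"
    using deficit_nonneg[OF W(1,2)] deficit_half_le[OF fin F j, of b] by (auto simp: dX_def dF_def W_def X_def)
  have dY: "0 \<le> 2 ^ k * deficit W Y" using deficit_nonneg[OF W(1,3)] by simp
  have yx: "y \<le> x" using x y by simp
  have split: "dF = (dX + 2 ^ k * deficit W Y) / 2 + tgap x y + 2 ^ k * meas W (Y - X)"
    unfolding dF_def dX_def W_def X_def Y_def
    by (rule deficit_half_scaled[OF fin F j _ _ _ x(2)]) (use yx in \<open>simp_all add: x_def y_def W_def X_def Y_def\<close>)
  have tg: "0 \<le> tgap x y" using x y by (intro tgap_nonneg) auto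
  have unscale: "u \<le> v" if "2 ^ k * u \<le> 2 ^ k * v" for u v :: real using that by simp
  show ?thesis
  proof (cases "y \<le> 128 * (dF - dX / 2)")
    case True
    have "meas W Y \<le> 128 * (deficit V F - deficit W X / 2)"
      by (rule unscale) (use True in \<open>simp add: y_def dF_def dX_def algebra_simps\<close>)
    moreover have "deficit W X \<ge> 0" using deficit_nonneg[OF W(1,2)] .
    ultimately show ?thesis using j by (intro bexI[of _ j] exI[of _ b]) (auto simp: W_def X_def Y_def)
  next
    case False
    then have small: "tgap x y < y / 128" "2 ^ k * meas W (Y - X) < y / 128"
      using split dY tg mult_nonneg_nonneg[of "2 ^ k" "meas W (Y - X)"] by (simp_all only: meas_nonneg zero_le_power zero_le_numeral simp_thms) argo+
    have x_half: "\<bar>x - 1/2\<bar> \<le> y / 64" using tight_light_side[OF _ _ y small(1)] xy M by simp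
    define q1 where "q1 = \<bar>2 * (2 ^ k * meas W X) - 1\<bar>"
    have q1: "0 \<le> q1" "q1 \<le> y / 32" using x_half unfolding q1_def x_def[symmetric] by (auto simp: abs_if)
    have "tak q1 \<le> 11 / 1024" using tak_small[of q1 10] q1 y by simp
    then have D1: "2 * (2 ^ k * deficit W X + tak q1 / 2 + 2 * q1) \<le> 1/32"
      using dX d q1 y unfolding dX_def[symmetric] dF_def[symmetric] by simp
    then obtain i c where i: "i \<in> W" "2 ^ k * meas (W - {i}) (half i c X) \<le> 2 * (1/32)"
      using near_half_light_side[OF W(1,2) q1_def, of "1/32"] q1 y by auto
    \<comment> \<open>The two halves of \<open>X\<close> at coordinate \<open>i\<close>, and the
      part of \<open>Y\<close> parallel to the light one.\<close>
    define s t w where "s = 2 ^ k * meas (W - {i}) (half i c X)"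
      and "t = 2 ^ k * meas (W - {i}) (half i (\<not> c) X)" and "w = 2 ^ k * meas (W - {i}) (half i c Y)"
    have s: "0 \<le> s" "s \<le> 1/16" using i(2) by (auto simp: s_def)
    have st: "s + t = 2 * x" unfolding s_def t_def x_def meas_half[OF W(1,2) i(1), of c]
      by (simp add: distrib_left)
    have ij: "i \<in> V" "j \<in> V - {i}" "i \<noteq> j" using i(1) j by (auto simp: W_def)
    have Vij: "V - {i} - {j} = W - {i}" by (auto simp: W_def)
    have "meas (V - {i}) (half i c F) = (meas (W - {i}) (half i c X) + meas (W - {i}) (half i c Y)) / 2"
      using meas_half[OF _ half_subset[OF F] ij(2), of c b] fin half_commute[OF ij(3)] Vij
      by (auto simp: X_def Y_def)
    then have "meas W Y \<le> (meas (W - {i}) (half i c X) + meas (W - {i}) (half i c Y)) / 2"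
      using minimal[OF ij(1), of c] by (simp add: W_def Y_def)
    then have "2 ^ k * meas W Y \<le> 2 ^ k * ((meas (W - {i}) (half i c X) + meas (W - {i}) (half i c Y)) / 2)"
      by (intro mult_left_mono) auto
    then have y_sw: "y \<le> (s + w) / 2" by (simp only: y_def s_def w_def distrib_left times_divide_eq_right)
    have w_s: "w \<le> s + y / 64"
    proof -
      have YX: "Y - X \<subseteq> Pow W" using W by blast
      have "half i c (Y - X) = half i c Y - half i c X" by (auto simp: half_def)
      then have "meas (W - {i}) (half i c Y - half i c X) \<le> 2 * meas W (Y - X)"
        using meas_half_le[OF W(1) YX i(1), of c] by simp
      moreover have "meas (W - {i}) (half i c Y) \<le> meas (W - {i}) (half i c X) + meas (W - {i}) (half i c Y - half i c X)"
        using meas_Diff[OF _ half_subset[OF W(3)] half_subset[OF W(2)], of i c c] W(1)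
          meas_nonneg[of "W - {i}" "half i c X - half i c Y"] by (smt (verit) finite_Diff)
      ultimately have "meas (W - {i}) (half i c Y) \<le> meas (W - {i}) (half i c X) + 2 * meas W (Y - X)" by linarith
      then have "2 ^ k * meas (W - {i}) (half i c Y) \<le> 2 ^ k * (meas (W - {i}) (half i c X) + 2 * meas W (Y - X))"
        by (intro mult_left_mono) auto
      then have "w \<le> s + 2 * (2 ^ k * meas W (Y - X))" by (simp add: w_def s_def distrib_left)
      then show ?thesis using small(2) by simp
    qed
    \<comment> \<open>Minimality of \<open>Y\<close> makes \<open>s\<close> at least comparable to
      \<open>y\<close>, so errors proportional to \<open>y\<close> can be charged to
      \<open>s\<close>.\<close>
    have y2s: "y \<le> 2 * s" using y_sw w_s y by argo
    have t: "1/2 \<le> t" "t \<le> 1" "s \<le> t" using st s x x_half y2s y by (auto simp: abs_if split: if_splits)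
    have gap: "tak (2 * s) / 8 \<le> tgap t s"
    proof -
      \<comment> \<open>\<open>4 * x\<close> is within \<open>s / 8\<close> of the integer 2, so the
        subtracted Takagi value is a small fraction of \<open>tak (2 * s)\<close>.\<close>
      have "2 * t + 2 * s = 4 * x" using st by simp
      then have "tak (2 * t + 2 * s) = tak (4 * x - 2)"
        using tak_plus_int[of "4 * x" "-2"] by simp
      also have "\<dots> = tak \<bar>4 * x - 2\<bar>" using tak_minus[of "4 * x - 2"] by (auto simp: abs_if)
      also have "\<dots> \<le> (4 + 2) / 2 ^ 4 * tak (2 * s)"
        using tak_rel_small[of "\<bar>4 * x - 2\<bar>" "2 * s" 4] x_half y2s s by (auto simp: abs_if split: if_splits)
      finally show ?thesis using tgap_straddle[of s t] t s tak_nonneg[of "2 * t"] tak_nonneg[of "2 * s"] by simp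
    qed
    have gap_dX: "tgap t s \<le> dX"
    proof -
      let ?P = "half i (\<not> c) X" and ?Q = "half i c X"
      have "0 \<le> 2 ^ k * deficit (W - {i}) ?P" "0 \<le> 2 ^ k * deficit (W - {i}) ?Q" "0 \<le> 2 ^ k * meas (W - {i}) (?Q - ?P)"
        using deficit_nonneg[OF _ half_subset[OF W(2)]] W(1) by auto
      moreover have "dX = (2 ^ k * deficit (W - {i}) ?P + 2 ^ k * deficit (W - {i}) ?Q) / 2
          + tgap t s + 2 ^ k * meas (W - {i}) (?Q - ?P)"
        using deficit_half_scaled[OF W(1,2) i(1) t_def _ t(3,2)] unfolding dX_def s_def by simp
      ultimately show ?thesis by argo
    qed
    have tak_s: "tak (2 * s) \<le> 8 * dX" "2 * s \<le> tak (2 * s)"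
      using gap gap_dX tak_ge[of "2 * s"] s by auto
    obtain K where K: "subcube W K" "2 ^ k * meas W (sym_diff X K) \<le> 2 * (2 ^ k * deficit W X + tak q1 / 2 + 2 * q1)"
      using near_half_subcube[OF W(1,2) q1_def] q1 y by auto
    have "tak q1 \<le> (5 + 2) / 2 ^ 5 * tak (2 * s)"
      using tak_rel_small[of q1 "2 * s" 5] q1 y2s s by simp
    then have XK: "2 ^ k * meas W (sym_diff X K) \<le> 6 * dX"
      using K(2) tak_s q1 y2s unfolding dX_def[symmetric] by simp
    have "subcube V (glue j b K {})" using subcube_glue_empty[of V j K b] K(1) j by (simp add: W_def)
    \<comment> \<open>After scaling, the error \<open>6 * dX\<close> on \<open>X\<close> and
      \<open>y \<le> 8 * dX\<close> average to \<open>7 * dX\<close>, and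
      \<open>dX \<le> 2 * dF\<close>.\<close>
    moreover have "meas V (sym_diff F (glue j b K {})) \<le> 14 * deficit V F"
    proof (rule unscale)
      have "meas V (sym_diff F (glue j b K {})) = (meas W (sym_diff X K) + meas W Y) / 2"
        using meas_dist_glue[OF fin j F, of K "{}" b] subcube_subset[OF K(1)] by (simp add: W_def X_def Y_def)
      then have "2 ^ k * meas V (sym_diff F (glue j b K {})) = (2 ^ k * meas W (sym_diff X K) + y) / 2"
        by (simp only: y_def distrib_left times_divide_eq_right)
      also have "\<dots> \<le> 14 * dF" using XK tak_s y2s dX by simp
      finally show "2 ^ k * meas V (sym_diff F (glue j b K {})) \<le> 2 ^ k * (14 * deficit V F)" by (simp add: dF_def)
    qed
    moreover have "meas W Y \<le> 128 * deficit V F"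
    proof (rule unscale)
      have "y \<le> 128 * dF" using tak_s y2s dX by simp
      then show "2 ^ k * meas W Y \<le> 2 ^ k * (128 * deficit V F)" unfolding y_def dF_def by simp
    qed
    ultimately show ?thesis using j by (intro bexI[of _ j] exI[of _ b]) (auto simp: W_def Y_def)
  qed
qed

section \<open>Light sides away from powers of two\<close>

lemma power_mean:
  fixes x y :: real
  assumes "0 \<le> x" "0 \<le> y"
  shows "((x + y) / 2) ^ K \<le> (x ^ K + y ^ K) / 2"
proof (induction K)
  case (Suc K)
  have "0 \<le> (x - y) * (x ^ K - y ^ K)"
    using assms power_mono[of x y K] power_mono[of y x K] by (cases "x \<le> y") (auto simp: zero_le_mult_iff)
  then have *: "x * y ^ K + y * x ^ K \<le> x * x ^ K + y * y ^ K" by (simp add: algebra_simps)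
  have "((x + y) / 2) ^ Suc K \<le> (x + y) / 2 * ((x ^ K + y ^ K) / 2)"
    unfolding power_Suc using Suc.IH assms by (intro mult_left_mono) auto
  also have "\<dots> = (x * x ^ K + y * y ^ K + (x * y ^ K + y * x ^ K)) / 4" by (simp add: field_simps)
  also have "\<dots> \<le> (x ^ Suc K + y ^ Suc K) / 2" using * by simp
  finally show ?case .
qed simp

text \<open>The margin 1/2048 above 1/4 puts the heavy side past 1/2 by at least the scaled density
  y of the light side, so the straddling gap is at least y / 2. A moderately light side is thus
  bounded by the deficit that the split contributes.\<close>

lemma light_side_gap:
  assumes "finite V" "F \<subseteq> Pow V" "j \<in> V"
    and M: "1/4 + 1/2048 \<le> 2 ^ k * meas V F" "2 ^ k * meas V F \<le> 1/2"
    and s: "2 ^ k * meas (V - {j}) (half j (\<not> b) F) \<le> 1/4096"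
  shows "2 ^ k * meas (V - {j}) (half j (\<not> b) F)
    \<le> 2 * (2 ^ k * deficit V F - 2 ^ k * deficit (V - {j}) (half j b F) / 2)"
proof -
  define W X Y where "W = V - {j}" and "X = half j b F" and "Y = half j (\<not> b) F"
  have W: "finite W" "X \<subseteq> Pow W" "Y \<subseteq> Pow W" using assms half_subset[OF assms(2)] by (auto simp: W_def X_def Y_def)
  define x y where "x = 2 ^ k * meas W X" and "y = 2 ^ k * meas W Y"
  have "meas V F = (meas W X + meas W Y) / 2" using meas_half[OF assms(1-3), of b] by (simp add: W_def X_def Y_def)
  then have xy: "2 ^ k * meas V F = (x + y) / 2" by (simp only: x_def y_def distrib_left times_divide_eq_right)
  have y: "0 \<le> y" "y \<le> 1/4096" using s by (auto simp: y_def W_def Y_def)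
  have x: "1/2 + 1/4096 \<le> x" "x \<le> 1" "y \<le> x" "x + y \<le> 1" using xy M y by auto
  have "2 ^ k * deficit V F = (2 ^ k * deficit W X + 2 ^ k * deficit W Y) / 2 + tgap x y + 2 ^ k * meas W (Y - X)"
    unfolding W_def X_def Y_def
    by (rule deficit_half_scaled[OF assms(1-3) _ _ _ x(2)]) (use x in \<open>simp_all add: x_def y_def W_def X_def Y_def\<close>)
  moreover have "0 \<le> 2 ^ k * deficit W Y" "0 \<le> 2 ^ k * meas W (Y - X)" using deficit_nonneg[OF W(1,3)] by auto
  moreover have "min (x - 1/2) y / 2 \<le> tgap x y" using x y by (intro tgap_straddle_low) auto
  moreover have "min (x - 1/2) y = y" using x y by simp
  ultimately have "y \<le> 2 * (2 ^ k * deficit V F - 2 ^ k * deficit W X / 2)" by argo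
  then show ?thesis by (simp only: y_def W_def X_def Y_def)
qed

text \<open>A side of \<open>F\<close> averages the corresponding sides of its two halves, and one
  of these exceeds the other by no more than twice the part of its half outside the other
  half.\<close>

lemma half_transfer:
  assumes "finite V" "F \<subseteq> Pow V" "i \<in> V" "j \<in> V - {i}"
  shows "meas (V - {j}) (half j c F)
    \<le> meas (V - {i} - {j}) (half j c (half i b F)) + meas (V - {i}) (half i (\<not> b) F - half i b F)"
proof -
  define U X Y where "U = V - {i} - {j}" and "X = half i b F" and "Y = half i (\<not> b) F"
  have ij: "i \<noteq> j" "i \<in> V - {j}" using assms by auto
  have U: "V - {j} - {i} = U" by (auto simp: U_def)
  have XY: "X \<subseteq> Pow (V - {i})" "Y \<subseteq> Pow (V - {i})" using half_subset[OF assms(2)] by (auto simp: X_def Y_def)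
  have sub: "half j c X \<subseteq> Pow U" "half j c Y \<subseteq> Pow U" using half_subset[OF XY(1)] half_subset[OF XY(2)] by (auto simp: U_def)
  have "meas (V - {j}) (half j c F) = (meas U (half i b (half j c F)) + meas U (half i (\<not> b) (half j c F))) / 2"
    using meas_half[OF _ half_subset[OF assms(2)] ij(2), of c b] assms(1) U by simp
  then have 1: "meas (V - {j}) (half j c F) = (meas U (half j c X) + meas U (half j c Y)) / 2"
    using half_commute[OF ij(1)] by (simp add: X_def Y_def)
  have "meas U (half j c Y) = meas U (half j c X) + meas U (half j c Y - half j c X) - meas U (half j c X - half j c Y)"
    using meas_Diff[OF _ sub(2,1)] assms(1) by (simp add: U_def)
  then have 2: "meas U (half j c Y) \<le> meas U (half j c X) + meas U (half j c Y - half j c X)"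
    using meas_nonneg[of U "half j c X - half j c Y"] by argo
  have "half j c (Y - X) = half j c Y - half j c X" by (auto simp: half_def)
  moreover have "Y - X \<subseteq> Pow (V - {i})" using XY by blast
  ultimately have 3: "meas U (half j c Y - half j c X) \<le> 2 * meas (V - {i}) (Y - X)"
    using meas_half_le[of "V - {i}" "Y - X" j c] assms by (simp add: U_def)
  show ?thesis using 1 2 3 unfolding U_def X_def Y_def by argo
qed

lemma near_half_tiny_side:
  assumes "finite V" "F \<subseteq> Pow V" "\<bar>2 ^ k * meas V F - 1/2\<bar> \<le> 1 / 2 ^ 23" "2 ^ k * deficit V F \<le> 1 / 2 ^ 20"
  shows "\<exists>j\<in>V. \<exists>b. 2 ^ k * meas (V - {j}) (half j b F) \<le> 1/8192"
proof -
  define q where "q = \<bar>2 * (2 ^ k * meas V F) - 1\<bar>"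
  have q: "0 \<le> q" "q \<le> 1 / 2 ^ 22" unfolding q_def using assms(3) by (simp_all add: abs_if split: if_splits)
  have "tak q \<le> 23 / 2 ^ 22" using tak_small[OF q] by simp
  then have "2 * (2 ^ k * deficit V F + tak q / 2 + 2 * q) \<le> 1/16384" using q assms(4) by simp
  then show ?thesis using near_half_light_side[OF assms(1,2) q_def, of "1/16384"] q by simp
qed

text \<open>The threshold \<open>M ^ K\<close> is convex in the density \<open>M\<close>, so one of the halves inherits the hypothesis when
  the split is balanced, and it at least doubles when \<open>M\<close> grows by the factor \<open>1 + 1 / 2 ^ 23\<close>, so the
  heavy half inherits it otherwise.\<close>

lemma light_side_exists_aux:
  assumes K: "2 \<le> (1 + 1 / 2 ^ 23 :: real) ^ K" and "finite V" "F \<subseteq> Pow V"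
    and "1/4 + 1/2048 \<le> 2 ^ k * meas V F" "2 ^ k * meas V F \<le> 1/2"
    and "2 ^ k * deficit V F \<le> (2 ^ k * meas V F) ^ K / 2 ^ 30"
  shows "\<exists>j\<in>V. \<exists>b. 2 ^ k * meas (V - {j}) (half j b F) \<le> 1/8192"
  using assms(2-)
proof (induction V arbitrary: F rule: finite_induct)
  case empty
  \<comment> \<open>Without coordinates the scaled density is 0 or at least 1, outside the assumed
    range.\<close>
  have "(1::real) \<le> 2 ^ k" by simp
  then have "\<not> (2::real) ^ k * 2 \<le> 1" by linarith
  then show ?case using family_on_empty[OF empty(1)] empty(2,3) by (auto simp: meas_def)
next
  case (insert i W)
  let ?V = "insert i W"
  have VW: "?V - {i} = W" and V: "finite ?V" "i \<in> ?V" using insert.hyps by auto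
  note F = insert.prems(1)
  have sub: "half i c F \<subseteq> Pow W" for c using half_subset[OF F, of i c] VW by simp
  define M d where "M = 2 ^ k * meas ?V F" and "d = 2 ^ k * deficit ?V F"
  have M: "1/4 + 1/2048 \<le> M" "M \<le> 1/2" using insert.prems by (auto simp: M_def)
  have dM: "d \<le> M ^ K / 2 ^ 30" using insert.prems by (simp add: M_def d_def)
  have pow1: "z ^ K / 2 ^ 30 \<le> 1 / 2 ^ 30" if "0 \<le> z" "z \<le> 1" for z :: real
    using power_le_one[OF that, of K] by (simp add: divide_right_mono)
  have d: "0 \<le> d" "d \<le> 1 / 2 ^ 30"
    using deficit_nonneg[OF V(1) F] dM pow1[of M] M by (auto simp: d_def)
  define m where "m c = 2 ^ k * meas W (half i c F)" for c
  define e where "e c = 2 ^ k * deficit W (half i c F)" for c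
  have e: "0 \<le> e c" "e c \<le> 2 * d" for c
  proof -
    show "0 \<le> e c" using deficit_nonneg[OF insert.hyps(1) sub] by (simp add: e_def)
    have "deficit W (half i c F) \<le> 2 * deficit ?V F" using deficit_half_le[OF V(1) F V(2), of c] VW by simp
    then show "e c \<le> 2 * d" by (simp add: e_def d_def)
  qed
  have msum: "M = (m c + m (\<not> c)) / 2" for c
  proof -
    have "meas ?V F = (meas W (half i c F) + meas W (half i (\<not> c) F)) / 2" using meas_half[OF V(1) F V(2), of c] VW by simp
    then show ?thesis by (simp only: M_def m_def distrib_left times_divide_eq_right)
  qed
  have m0: "0 \<le> m c" for c by (simp add: m_def)
  obtain b where b: "m (\<not> b) \<le> m b"
    by (cases "m True \<le> m False") (force intro: that[of False] that[of True])+
  have mb1: "m b \<le> 1" using msum[of b] m0[of "\<not> b"] M by argo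
  have split: "d = (e b + e (\<not> b)) / 2 + tgap (m b) (m (\<not> b)) + 2 ^ k * meas W (half i (\<not> b) F - half i b F)"
    using deficit_half_scaled[OF V(1) F V(2) _ _ b mb1] VW by (simp add: d_def e_def m_def)
  have ex0: "0 \<le> 2 ^ k * meas W (half i (\<not> b) F - half i b F)" by simp
  have tg0: "0 \<le> tgap (m b) (m (\<not> b))" using m0 mb1 b by (intro tgap_nonneg) (auto intro: order_trans)
  have ex: "2 ^ k * meas W (half i (\<not> b) F - half i b F) \<le> d" using split e(1)[of b] e(1)[of "\<not> b"] tg0 by argo
  \<comment> \<open>Used for balanced splits, where either half may be the one that inherits the
    hypothesis and the difference of densities is negligible.\<close>
  have ex': "2 ^ k * meas W (half i (\<not> c) F - half i c F) \<le> (m b - m (\<not> b)) + d" for c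
  proof (cases "c = b")
    case True
    then show ?thesis using ex b by simp
  next
    case False
    then have c: "c = (\<not> b)" by auto
    have "meas W (half i b F) = meas W (half i (\<not> b) F) + meas W (half i b F - half i (\<not> b) F) - meas W (half i (\<not> b) F - half i b F)"
      using meas_Diff[OF insert.hyps(1) sub sub] .
    then have "m b = m (\<not> b) + 2 ^ k * meas W (half i b F - half i (\<not> b) F) - 2 ^ k * meas W (half i (\<not> b) F - half i b F)"
      unfolding m_def by (metis distrib_left right_diff_distrib)
    then show ?thesis using ex c by simp
  qed
  text \<open>A light side of a half is a light side of \<open>F\<close>, and \<open>light_side_gap\<close> restores the bound.\<close>
  have transfer: ?case if j: "j \<in> W" "2 ^ k * meas (W - {j}) (half j c' (half i c F)) \<le> 1/8192"
    and small: "2 ^ k * meas W (half i (\<not> c) F - half i c F) \<le> 1/8192" for j c c'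
  proof -
    have jV: "j \<in> ?V" "j \<in> ?V - {i}" using j(1) insert.hyps by auto
    have "meas (?V - {j}) (half j c' F) \<le> meas (W - {j}) (half j c' (half i c F)) + meas W (half i (\<not> c) F - half i c F)"
      using half_transfer[OF V(1) F V(2) jV(2), of c' c] VW by simp
    then have "2 ^ k * meas (?V - {j}) (half j c' F) \<le> 2 ^ k * (meas (W - {j}) (half j c' (half i c F)) + meas W (half i (\<not> c) F - half i c F))"
      by (intro mult_left_mono) auto
    then have "2 ^ k * meas (?V - {j}) (half j c' F) \<le> 1/4096" unfolding distrib_left using j(2) small by argo
    then have "2 ^ k * meas (?V - {j}) (half j c' F) \<le> 2 * (d - 2 ^ k * deficit (?V - {j}) (half j (\<not> c') F) / 2)"
      using light_side_gap[OF V(1) F jV(1), of k "\<not> c'"] M unfolding M_def d_def by simp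
    moreover have "0 \<le> 2 ^ k * deficit (?V - {j}) (half j (\<not> c') F)"
      using deficit_nonneg[OF _ half_subset[OF F]] V(1) by simp
    ultimately have "2 ^ k * meas (?V - {j}) (half j c' F) \<le> 1/8192" using d by simp
    then show ?thesis using jV(1) by blast
  qed
  consider "1/2 - 1 / 2 ^ 23 \<le> M" | "M < 1/2 - 1 / 2 ^ 23" "m b - m (\<not> b) \<le> 1 / 2 ^ 23"
    | "M < 1/2 - 1 / 2 ^ 23" "m b - m (\<not> b) > 1 / 2 ^ 23" by linarith
  then show ?case
  proof cases
    case 1
    then have "\<bar>M - 1/2\<bar> \<le> 1 / 2 ^ 23" using M by (simp add: abs_if)
    then show ?thesis using near_half_tiny_side[OF V(1) F] d by (simp add: M_def d_def)
  next
    case 2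
    \<comment> \<open>If both halves were above their thresholds, then by convexity so would be
      their mean, contradicting the bound on \<open>d\<close>.\<close>
    have "M ^ K \<le> (m True ^ K + m False ^ K) / 2" using power_mean[OF m0 m0, of True False K] msum[of True] by (simp only: not_True_eq_False)
    moreover have "e True + e False \<le> 2 * d"
    proof -
      have "e True + e False = e b + e (\<not> b)" by (cases b) auto
      then show ?thesis using split tg0 ex0 by argo
    qed
    ultimately have "e True \<le> m True ^ K / 2 ^ 30 \<or> e False \<le> m False ^ K / 2 ^ 30"
      using dM by (simp add: field_simps) argo
    then obtain c where c: "e c \<le> m c ^ K / 2 ^ 30" by metis
    have mc: "\<bar>m c - M\<bar> \<le> 1 / 2 ^ 24" 
    proof -
      have "m c = m b \<or> m c = m (\<not> b)" by (cases "c = b") auto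
      then show ?thesis using msum[of b] b 2(2) unfolding abs_le_iff by auto
    qed
    have mc2: "1/4 \<le> m c" "m c \<le> 1/2" using mc M 2(1) by (auto simp: abs_if split: if_splits)
    have ec: "e c \<le> 1 / 2 ^ 30" using pow1[of "m c"] mc2 c by simp
    have "\<exists>j\<in>W. \<exists>c'. 2 ^ k * meas (W - {j}) (half j c' (half i c F)) \<le> 1/8192"
    \<comment> \<open>The chosen half may have dropped out of the range of the induction hypothesis;
      near 1/4 \<open>near_quarter\<close> takes over.\<close>
    proof (cases "m c \<le> 1/4 + 1/2048")
      case True
      then have "\<exists>j\<in>W. \<exists>b'. meas (W - {j}) (half j (\<not> b') (half i c F)) \<le> 128 * deficit W (half i c F)"
        using near_quarter[OF insert.hyps(1) sub, of k c] mc2 ec unfolding m_def e_def by fastforce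
      then obtain j b' where j: "j \<in> W" "meas (W - {j}) (half j (\<not> b') (half i c F)) \<le> 128 * deficit W (half i c F)" by blast
      have "2 ^ k * meas (W - {j}) (half j (\<not> b') (half i c F)) \<le> 2 ^ k * (128 * deficit W (half i c F))"
        using j(2) by (intro mult_left_mono) auto
      also have "\<dots> \<le> 1/8192" using ec by (simp add: e_def)
      finally show ?thesis using j(1) by blast
    next
      case False
      then show ?thesis using insert.IH[OF sub, of c] mc2 c by (simp add: m_def e_def)
    qed
    moreover have "2 ^ k * meas W (half i (\<not> c) F - half i c F) \<le> 1/8192" using ex'[of c] 2(2) d by simp
    ultimately show ?thesis using transfer by blast
  next
    case 3
    have small: "2 ^ k * meas W (half i (\<not> b) F - half i b F) \<le> 1/8192" using ex d by simp
    \<comment> \<open>If the heavy half passes 1/2, the light half is itself a light side. Near 1/2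
      the subcube argument applies, and below it the induction hypothesis.\<close>
    consider "m b \<ge> 1/2 + 1 / 2 ^ 23" | "\<bar>m b - 1/2\<bar> \<le> 1 / 2 ^ 23" | "m b < 1/2 - 1 / 2 ^ 23" by linarith
    then show ?thesis
    proof cases
      case 1
      have mm: "m b + m (\<not> b) \<le> 1" "m (\<not> b) \<le> 1/2" using msum[of b] M 1 by auto
      have "min (m b - 1/2) (m (\<not> b)) / 2 \<le> tgap (m b) (m (\<not> b))"
        using mm 1 mb1 m0 by (intro tgap_straddle_low) auto
      also have "\<dots> \<le> d" using split e(1)[of b] e(1)[of "\<not> b"] ex0 by argo
      finally have "m (\<not> b) \<le> 2 * d" using 1 d unfolding min_def by (auto split: if_splits)
      then have "m (\<not> b) \<le> 1/8192" using d by simp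
      then show ?thesis using V(2) VW by (intro bexI[of _ i] exI[of _ "\<not> b"]) (simp_all add: m_def)
    next
      case 2
      have "e b \<le> 1 / 2 ^ 20" using e(2)[of b] d by simp
      then have "\<exists>j\<in>W. \<exists>c'. 2 ^ k * meas (W - {j}) (half j c' (half i b F)) \<le> 1/8192"
        using near_half_tiny_side[OF insert.hyps(1) sub] 2 by (simp add: m_def e_def)
      then show ?thesis using transfer small by blast
    next
      case 4: 3
      \<comment> \<open>\<open>m b - M\<close> is half the imbalance, hence above
        \<open>1 / 2 ^ 24\<close>; as \<open>M \<le> 1/2\<close>, this is a relative gain of
        \<open>1 / 2 ^ 23\<close>. By the choice of \<open>K\<close> it doubles the threshold, which
        offsets \<open>e b \<le> 2 * d\<close>.\<close>
      have "M * (1 / 2 ^ 23) \<le> 1/2 * (1 / 2 ^ 23)" using M by (intro mult_right_mono) auto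
      then have "M * (1 + 1 / 2 ^ 23) \<le> m b" using msum[of b] 3(2) by (simp add: distrib_left)
      then have "(M * (1 + 1 / 2 ^ 23)) ^ K \<le> m b ^ K" using M by (intro power_mono) auto
      moreover have "M ^ K * 2 \<le> M ^ K * (1 + 1 / 2 ^ 23) ^ K" using K M by (intro mult_left_mono) auto
      ultimately have "2 * M ^ K \<le> m b ^ K" by (simp only: power_mult_distrib)
      then have "e b \<le> m b ^ K / 2 ^ 30" using e(2)[of b] dM by (simp add: field_simps)
      moreover have "M \<le> m b" using msum[of b] b by argo
      ultimately have "\<exists>j\<in>W. \<exists>c'. 2 ^ k * meas (W - {j}) (half j c' (half i b F)) \<le> 1/8192"
        using insert.IH[OF sub, of b] 4 M by (simp add: m_def e_def)
      then show ?thesis using transfer small by blast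
    qed
  qed
qed

lemma light_side_exists:
  "\<exists>\<eta>>0. \<forall>V (F :: 'a set set) k. finite V \<longrightarrow> F \<subseteq> Pow V \<longrightarrow>
     1/4 + 1/2048 \<le> 2 ^ k * meas V F \<longrightarrow> 2 ^ k * meas V F \<le> 1/2 \<longrightarrow> 2 ^ k * deficit V F \<le> \<eta> \<longrightarrow>
     (\<exists>j\<in>V. \<exists>b. 2 ^ k * meas (V - {j}) (half j b F) \<le> 1/8192)"
proof -
  obtain K where "2 < (1 + 1 / 2 ^ 23 :: real) ^ K" using real_arch_pow[of "1 + 1 / 2 ^ 23" 2] by auto
  then have K: "2 \<le> (1 + 1 / 2 ^ 23 :: real) ^ K" by simp
  show ?thesis
  \<comment> \<open>Scaled densities are at least 1/4, so this constant is below every threshold of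
    \<open>light_side_exists_aux\<close>.\<close>
  proof (intro exI[of _ "(1/4) ^ K / 2 ^ 30 :: real"] conjI allI impI)
    fix V and F :: "'a set set" and k :: nat
    assume a: "finite V" "F \<subseteq> Pow V" "1/4 + 1/2048 \<le> 2 ^ k * meas V F" "2 ^ k * meas V F \<le> 1/2"
      "2 ^ k * deficit V F \<le> (1/4) ^ K / 2 ^ 30"
    have "(1/4 :: real) ^ K \<le> (2 ^ k * meas V F) ^ K" using a(3) by (intro power_mono) auto
    then have "(1/4) ^ K / 2 ^ 30 \<le> (2 ^ k * meas V F) ^ K / 2 ^ 30" by (intro divide_right_mono) auto
    then have "2 ^ k * deficit V F \<le> (2 ^ k * meas V F) ^ K / 2 ^ 30" using a(5) by linarith
    then show "\<exists>j\<in>V. \<exists>b. 2 ^ k * meas (V - {j}) (half j b F) \<le> 1/8192"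
      using light_side_exists_aux[OF K a(1-4)] by blast
  qed simp
qed

section \<open>Initial segments for arbitrary orders of the coordinates\<close>

text \<open>The list runs from the most to the least significant coordinate, each with its preferred
  membership. Deviations from the preferences are the binary digits of the rank.\<close>

fun lex_rank :: "('a \<times> bool) list \<Rightarrow> 'a set \<Rightarrow> nat" where
  "lex_rank [] S = 0"
| "lex_rank ((i, b) # r) S = (if (i \<in> S) = b then 0 else 2 ^ length r) + lex_rank r S"

definition coord_order :: "'a set \<Rightarrow> ('a \<times> bool) list \<Rightarrow> bool" where
  "coord_order V r \<longleftrightarrow> distinct (map fst r) \<and> fst ` set r = V"

definition seg :: "'a set \<Rightarrow> ('a \<times> bool) list \<Rightarrow> nat \<Rightarrow> 'a set set" where
  "seg V r m = {S \<in> Pow V. lex_rank r S < m}"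

lemma seg_subset: "seg V r m \<subseteq> Pow V"
  by (auto simp: seg_def)

lemma coord_order_finite: "coord_order V r \<Longrightarrow> finite V"
  by (auto simp: coord_order_def)

lemma coord_order_length: "coord_order V r \<Longrightarrow> length r = card V"
  unfolding coord_order_def by (metis distinct_card length_map list.set_map)

lemma coord_order_Cons:
  "coord_order V ((i, b) # r) \<longleftrightarrow> i \<in> V \<and> coord_order (V - {i}) r"
  by (auto simp: coord_order_def)

lemma coord_order_card: "coord_order V ((i, b) # r) \<Longrightarrow> card V = Suc (card (V - {i}))"
  using coord_order_length[of V "(i, b) # r"] coord_order_length[of "V - {i}" r] by (simp add: coord_order_Cons)

lemma lex_rank_less: "lex_rank r S < 2 ^ length r"
  by (induction r S rule: lex_rank.induct) auto

lemma lex_rank_cong: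
  "(\<And>i. i \<in> fst ` set r \<Longrightarrow> i \<in> S \<longleftrightarrow> i \<in> T) \<Longrightarrow> lex_rank r S = lex_rank r T"
  by (induction r S rule: lex_rank.induct) auto

text \<open>Subtraction on naturals makes the second half empty as long as
  \<open>m \<le> 2 ^ length r\<close>.\<close>

lemma half_seg:
  assumes "coord_order V ((i, b) # r)"
  shows "half i b (seg V ((i, b) # r) m) = seg (V - {i}) r m"
    and "half i (\<not> b) (seg V ((i, b) # r) m) = seg (V - {i}) r (m - 2 ^ length r)"
proof -
  have iV: "i \<in> V" and i: "i \<notin> fst ` set r" using assms by (auto simp: coord_order_def)
  have "lex_rank r (insert i S) = lex_rank r S" for S using i by (intro lex_rank_cong) auto
  then show "half i b (seg V ((i, b) # r) m) = seg (V - {i}) r m"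
    "half i (\<not> b) (seg V ((i, b) # r) m) = seg (V - {i}) r (m - 2 ^ length r)"
    using iV by (auto simp: half_def seg_def less_diff_conv add.commute split: if_splits)
qed

lemma card_seg: "coord_order V r \<Longrightarrow> card (seg V r m) = min m (2 ^ card V)"
proof (induction r arbitrary: V m)
  case Nil
  then have "seg V [] m = (if m = 0 then {} else {{}})" "V = {}" by (auto simp: seg_def coord_order_def)
  then show ?case by auto
next
  case (Cons p r)
  obtain i b where p: "p = (i, b)" by (cases p)
  have co: "coord_order V ((i, b) # r)" "coord_order (V - {i}) r" using Cons.prems p by (auto simp: coord_order_Cons)
  define N where "N = card (V - {i})"
  have N: "card V = Suc N" "length r = N"
    using coord_order_card[OF co(1)] coord_order_length[OF co(2)] by (simp_all only: N_def)
  have "card (seg V (p # r) m) = min m (2 ^ N) + min (m - 2 ^ N) (2 ^ N)"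
    unfolding p card_half[OF coord_order_finite[OF co(1)] seg_subset, of "(i, b) # r" m i b]
      half_seg[OF co(1)] Cons.IH[OF co(2)] N(2) N_def[symmetric] ..
  then show ?case by (auto simp: min_def N(1))
qed

lemma seg_full: "coord_order V r \<Longrightarrow> 2 ^ card V \<le> m \<Longrightarrow> seg V r m = Pow V"
  using order_less_le_trans[OF lex_rank_less[of r]] coord_order_length[of V r] by (auto simp: seg_def)

lemma meas_seg: "coord_order V r \<Longrightarrow> m \<le> 2 ^ card V \<Longrightarrow> meas V (seg V r m) = m / 2 ^ card V"
  by (simp add: meas_def card_seg)

lemma bdry_empty: "bdry V {} = 0" and bdry_Pow: "bdry V (Pow V) = 0"
proof -
  have "half i True (Pow V) = half i False (Pow V)" if "i \<in> V" for i
    using that by (auto simp: half_def)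
  then show "bdry V (Pow V) = 0" by (simp add: bdry_def)
qed (simp add: bdry_def half_def)

text \<open>Initial segments have deficit 0: at the first coordinate either one half is empty or the
  other is full, and the recursion for \<open>bdry\<close> becomes \<open>tak_low\<close> or
  \<open>tak_high\<close>.\<close>

lemma bdry_seg: "coord_order V r \<Longrightarrow> m \<le> 2 ^ card V \<Longrightarrow> bdry V (seg V r m) = tak (m / 2 ^ card V)"
proof (induction r arbitrary: V m)
  case Nil
  then have "V = {}" by (simp add: coord_order_def)
  moreover have "m = 0 \<or> m = 1" using Nil.prems calculation by auto
  ultimately show ?case by (auto simp: bdry_def)
next
  case (Cons p r)
  obtain i b where p: "p = (i, b)" by (cases p)
  let ?W = "V - {i}"
  have co: "coord_order V ((i, b) # r)" "coord_order ?W r" and iV: "i \<in> V"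
    using Cons.prems p by (auto simp: coord_order_Cons)
  define N where "N = card ?W"
  have N: "card V = Suc N" "length r = N" using coord_order_card[OF co(1)] coord_order_length[OF co(2)] by (simp_all only: N_def)
  have fin: "finite V" using coord_order_finite co(1) .
  have eq: "bdry V (seg V (p # r) m) = (bdry ?W (seg ?W r m) + bdry ?W (seg ?W r (m - 2 ^ N))) / 2
      + meas ?W (sym_diff (seg ?W r m) (seg ?W r (m - 2 ^ N))) / 2"
    using bdry_half[OF fin seg_subset iV, of "p # r" m b] half_seg[OF co(1)] p N by simp
  show ?case
  proof (cases "m \<le> 2 ^ N")
    case True
    then have "seg ?W r (m - 2 ^ N) = {}" by (simp add: seg_def)
    then have "bdry V (seg V (p # r) m) = tak (m / 2 ^ N) / 2 + (m / 2 ^ N) / 2"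
      using eq Cons.IH[OF co(2)] meas_seg[OF co(2)] True by (simp add: bdry_empty N_def)
    moreover have "m / 2 ^ N \<le> (1::real)" using True by (simp add: field_simps flip: of_nat_power)
    ultimately show ?thesis using tak_low[of "m / 2 ^ N / 2"] by (simp add: N mult.commute)
  next
    case False
    define y where "y = (m - 2 ^ N) / (2 ^ N :: real)"
    have m: "m - 2 ^ N \<le> 2 ^ N" "real (m - 2 ^ N) = real m - 2 ^ N" using False Cons.prems N by auto
    then have my: "real (m - 2 ^ N) / 2 ^ N = y" by (simp add: y_def)
    have "real (m - 2 ^ N) \<le> 2 ^ N" using m(1) by (metis of_nat_le_iff of_nat_numeral of_nat_power)
    then have y: "0 \<le> y" "y \<le> 1" unfolding my[symmetric] by auto
    have full: "seg ?W r m = Pow ?W" using False seg_full[OF co(2)] by (simp add: N_def)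
    have sub: "seg ?W r (m - 2 ^ N) \<subseteq> Pow ?W" by (rule seg_subset)
    then have "seg ?W r (m - 2 ^ N) - Pow ?W = {}" by auto
    then have "meas ?W (seg ?W r (m - 2 ^ N) - Pow ?W) = 0" by (simp only: meas_empty)
    then have "meas ?W (sym_diff (Pow ?W) (seg ?W r (m - 2 ^ N))) = 1 - y"
      using meas_sym_diff_eq[OF _ order_refl sub] fin meas_seg[OF co(2)] m my by (simp add: meas_Pow N_def)
    then have "bdry V (seg V (p # r) m) = tak y / 2 + (1 - y) / 2"
      using eq full Cons.IH[OF co(2)] m my by (simp add: bdry_Pow N_def)
    moreover have "m / 2 ^ card V = (1 + y) / 2" using False by (simp add: y_def N field_simps)
    moreover have "tak ((1 + y) / 2) = (1 - y) / 2 + tak y / 2"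
      using tak_high[of "(1 + y) / 2"] y tak_double_minus_1[of "(1 + y) / 2"] by (simp add: field_simps)
    ultimately show ?thesis by (simp only: add.commute)
  qed
qed

lemma lex_rank_flip: "lex_rank (map (\<lambda>(i, b). (i, \<not> b)) r) S + lex_rank r S + 1 = 2 ^ length r"
  by (induction r S rule: lex_rank.induct) auto

lemma coord_order_flip: "coord_order V (map (\<lambda>(i, b). (i, \<not> b)) r) \<longleftrightarrow> coord_order V r"
  by (simp add: coord_order_def case_prod_unfold comp_def image_image)

text \<open>Flipping every preference reverses the order, since the two ranks add up to one less
  than the number of sets.\<close>

lemma seg_compl:
  assumes "coord_order V r" "m \<le> 2 ^ card V"
  shows "Pow V - seg V r m = seg V (map (\<lambda>(i, b). (i, \<not> b)) r) (2 ^ card V - m)"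
proof -
  have "\<not> lex_rank r S < m \<longleftrightarrow> lex_rank (map (\<lambda>(i, b). (i, \<not> b)) r) S < 2 ^ card V - m" for S
    using lex_rank_flip[of r S] coord_order_length[OF assms(1)] assms(2) by auto
  then show ?thesis by (auto simp: seg_def)
qed

lemma meas_compl:
  assumes "finite V" "F \<subseteq> Pow V"
  shows "meas V (Pow V - F) = 1 - meas V F"
proof -
  have "F - Pow V = {}" using assms(2) by auto
  then have "meas V (F - Pow V) = 0" by (simp only: meas_empty)
  then show ?thesis using meas_Diff[OF assms order_refl] meas_Pow[OF assms(1)] by linarith
qed

text \<open>A family and its complement have the same boundary edges, and \<open>tak\<close> is
  symmetric about 1/2. This reduces stability to density at most 1/2.\<close>

lemma deficit_compl:
  assumes "finite V" "F \<subseteq> Pow V"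
  shows "deficit V (Pow V - F) = deficit V F"
proof -
  have "half i b (Pow V - F) = Pow (V - {i}) - half i b F" if "i \<in> V" for i b
    using that by (auto simp: half_def)
  moreover have "half i b F \<subseteq> Pow (V - {i})" for i b using half_subset[OF assms(2)] .
  moreover have "sym_diff (P - A) (P - B) = sym_diff A B" if "A \<subseteq> P" "B \<subseteq> P" for A B P :: "'a set set"
    using that by auto
  ultimately have "sym_diff (half i True (Pow V - F)) (half i False (Pow V - F)) = sym_diff (half i True F) (half i False F)"
    if "i \<in> V" for i using that by simp
  then have "bdry V (Pow V - F) = bdry V F" by (simp add: bdry_def)
  then show ?thesis using meas_compl[OF assms] by (simp add: deficit_def tak_reflect)
qed

lemma meas_dist_seg:
  assumes "coord_order V r"
  shows "meas V (sym_diff (seg V r m) (seg V r m')) = \<bar>meas V (seg V r m) - meas V (seg V r m')\<bar>"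
proof -
  have *: "meas V (sym_diff (seg V r m) (seg V r m')) = \<bar>meas V (seg V r m) - meas V (seg V r m')\<bar>" if "m' \<le> m" for m m'
  proof -
    have "seg V r m' - seg V r m = {}" using that by (auto simp: seg_def)
    then have "meas V (seg V r m' - seg V r m) = 0" by (simp only: meas_empty)
    moreover have "meas V (seg V r m') \<le> meas V (seg V r m)"
      using coord_order_finite[OF assms] that by (intro meas_mono) (auto simp: seg_def)
    ultimately show ?thesis
      using meas_sym_diff_eq[OF coord_order_finite[OF assms] seg_subset seg_subset, of r m r m'] by linarith
  qed
  show ?thesis
  proof (cases "m' \<le> m")
    case False
    then show ?thesis using *[of m m'] by (simp add: abs_minus_commute Un_commute)
  qed (rule *)
qed

lemma coord_order_exists: "finite V \<Longrightarrow> \<exists>r. coord_order V r"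
proof -
  assume "finite V"
  then obtain xs where "distinct xs" "set xs = V" using finite_distinct_list by blast
  then have "coord_order V (map (\<lambda>i. (i, True)) xs)" by (auto simp: coord_order_def comp_def image_image)
  then show ?thesis by blast
qed

lemma lex_rank_append: "lex_rank (fs @ gs) S = 2 ^ length gs * lex_rank fs S + lex_rank gs S"
  by (induction fs S rule: lex_rank.induct) (auto simp: power_add algebra_simps)

lemma lex_rank_eq_0_iff: "lex_rank r S = 0 \<longleftrightarrow> (\<forall>(i, b)\<in>set r. (i \<in> S) = b)"
  by (induction r S rule: lex_rank.induct) auto

text \<open>Put the fixed coordinates first, preferring their fixed values, and the free ones after
  them.\<close>

lemma subcube_is_seg:
  assumes "finite V" "subcube V K"
  shows "\<exists>r. coord_order V r \<and> K = seg V r (card K)"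
proof (cases "K = {}")
  case True
  then show ?thesis using coord_order_exists[OF assms(1)] by (auto simp: seg_def)
next
  case False
  then obtain B U where BU: "B \<subseteq> U" "U \<subseteq> V" and K: "K = {S. B \<subseteq> S \<and> S \<subseteq> U}"
    using assms(2) by (auto simp: subcube_def)
  have "finite (V - U)" "finite B" "finite (U - B)" using BU assms(1) by (auto intro: finite_subset)
  then obtain as bs cs where l: "distinct as" "set as = V - U" "distinct bs" "set bs = B" "distinct cs" "set cs = U - B"
    using finite_distinct_list by metis
  define fs where "fs = map (\<lambda>i. (i, False)) as @ map (\<lambda>i. (i, True)) bs"
  define gs where "gs = map (\<lambda>i. (i, True)) cs"
  have co: "coord_order V (fs @ gs)"
    using l BU by (auto simp: coord_order_def fs_def gs_def comp_def image_Un image_image)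
  \<comment> \<open>The free coordinates contribute less than \<open>2 ^ length gs\<close>, so any
    mismatch among the fixed ones exceeds the bound.\<close>
  have "lex_rank (fs @ gs) S < 2 ^ length gs \<longleftrightarrow> lex_rank fs S = 0" for S
    using lex_rank_less[of gs S] by (cases "lex_rank fs S") (auto simp: lex_rank_append)
  moreover have "lex_rank fs S = 0 \<longleftrightarrow> B \<subseteq> S \<and> S \<inter> (V - U) = {}" for S
    using l by (auto simp: lex_rank_eq_0_iff fs_def)
  ultimately have eq: "K = seg V (fs @ gs) (2 ^ length gs)" using BU by (auto simp: K seg_def)
  have "length gs \<le> card V" using coord_order_length[OF co] by simp
  then have "card K = 2 ^ length gs" using card_seg[OF co, of "2 ^ length gs"] eq by simp
  then have "K = seg V (fs @ gs) (card K)" using eq by simp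
  then show ?thesis using co by blast
qed

section \<open>Stability\<close>

text \<open>At density at most 1/2 the extended segment lies inside side \<open>b\<close>. The light
  side is counted twice at weight 1/2: as missed by the segment, and as the lengthening from
  \<open>card X\<close> to \<open>card F\<close> on the heavy side.\<close>

lemma seg_extend:
  assumes fin: "finite V" and F: "F \<subseteq> Pow V" and j: "j \<in> V" and le: "meas V F \<le> 1/2"
    and r: "coord_order (V - {j}) r"
  shows "meas V (sym_diff F (seg V ((j, b) # r) (card F)))
    \<le> meas (V - {j}) (sym_diff (half j b F) (seg (V - {j}) r (card (half j b F)))) / 2
      + meas (V - {j}) (half j (\<not> b) F)"
proof -
  define W X Y where "W = V - {j}" and "X = half j b F" and "Y = half j (\<not> b) F"
  have W: "finite W" "X \<subseteq> Pow W" "Y \<subseteq> Pow W" using fin half_subset[OF F] by (auto simp: W_def X_def Y_def)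
  have rW: "coord_order W r" using r by (simp add: W_def)
  have co: "coord_order V ((j, b) # r)" using r j by (simp add: coord_order_Cons)
  have len: "length r = card W" "card V = Suc (card W)"
    using coord_order_length[OF rW] coord_order_card[OF co] by (simp_all add: W_def)
  have cF: "card F = card X + card Y" using card_half[OF fin F, of j b] by (simp add: X_def Y_def)
  have "real (card F) \<le> 2 ^ card W" using le by (simp add: meas_def len(2) field_simps)
  then have cFW: "card F \<le> 2 ^ card W" by (metis of_nat_le_iff of_nat_numeral of_nat_power)
  let ?G = "seg V ((j, b) # r) (card F)"
  have hG: "half j b ?G = seg W r (card F)" "half j (\<not> b) ?G = {}"
    using half_seg[OF co] cFW len(1) by (auto simp: W_def seg_def)
  have sub: "sym_diff F ?G \<subseteq> Pow V" using F seg_subset[of V] by blast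
  have "meas V (sym_diff F ?G) = (meas W (sym_diff X (seg W r (card F))) + meas W Y) / 2"
    using meas_half[OF fin sub j, of b] unfolding half_sym_diff hG by (simp add: W_def X_def Y_def)
  also have "meas W (sym_diff X (seg W r (card F)))
      \<le> meas W (sym_diff X (seg W r (card X))) + meas W (sym_diff (seg W r (card X)) (seg W r (card F)))"
    by (intro meas_dist_triangle W seg_subset)
  also have "meas W (sym_diff (seg W r (card X)) (seg W r (card F))) = meas W Y"
  proof -
    have "meas W (seg W r (card X)) = card X / 2 ^ card W"
      by (rule meas_seg[OF rW]) (use cF cFW in simp)
    moreover have "meas W (seg W r (card F)) = card F / 2 ^ card W" by (rule meas_seg[OF rW cFW])
    ultimately show ?thesis unfolding meas_dist_seg[OF rW] by (simp add: cF meas_def add_divide_distrib)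
  qed
  finally show ?thesis by (simp add: W_def X_def Y_def)
qed

lemma dyadic_scale:
  assumes "0 < (\<mu>::real)" "\<mu> \<le> 1/2"
  shows "\<exists>k. 1/4 < 2 ^ k * \<mu> \<and> 2 ^ k * \<mu> \<le> 1/2"
proof -
  have "\<exists>k. 1/4 < 2 ^ k * \<mu>"
  proof -
    obtain k where "1 / (4 * \<mu>) < 2 ^ k" using real_arch_pow[of 2] by auto
    then show ?thesis using assms(1) by (intro exI[of _ k]) (simp add: field_simps)
  qed
  then obtain k where k: "1/4 < 2 ^ k * \<mu>" "\<And>l. l < k \<Longrightarrow> \<not> 1/4 < 2 ^ l * \<mu>"
    using exists_least_iff[of "\<lambda>k. 1/4 < 2 ^ k * \<mu>"] by blast
  have "2 ^ k * \<mu> \<le> 1/2"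
  proof (cases k)
    case (Suc l)
    then show ?thesis using k(2)[of l] by simp
  qed (use assms in simp)
  then show ?thesis using k(1) by blast
qed

lemma meas_dist_le_add:
  assumes "finite V" "A \<subseteq> Pow V" "B \<subseteq> Pow V"
  shows "meas V (sym_diff A B) \<le> meas V A + meas V B"
  using meas_dist_triangle[OF assms(1,2) _ assms(3), of "{}"] by simp

theorem seg_stability:
  "\<exists>C>0. \<forall>V (F :: 'a set set). finite V \<longrightarrow> F \<subseteq> Pow V \<longrightarrow>
     (\<exists>r. coord_order V r \<and> meas V (sym_diff F (seg V r (card F))) \<le> C * deficit V F)"
proof -
  obtain \<eta> where \<eta>: "0 < \<eta>" and rough: "\<And>V (F :: 'a set set) k. finite V \<Longrightarrow> F \<subseteq> Pow V \<Longrightarrow>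
     1/4 + 1/2048 \<le> 2 ^ k * meas V F \<Longrightarrow> 2 ^ k * meas V F \<le> 1/2 \<Longrightarrow> 2 ^ k * deficit V F \<le> \<eta> \<Longrightarrow>
     \<exists>j\<in>V. \<exists>b. 2 ^ k * meas (V - {j}) (half j b F) \<le> 1/8192"
    using light_side_exists by metis
  define \<theta> where "\<theta> = min \<eta> (1/1024)"
  have \<theta>: "0 < \<theta>" "\<theta> \<le> \<eta>" "\<theta> \<le> 1/1024" using \<eta> by (auto simp: \<theta>_def)
  \<comment> \<open>128 is the price of a light side from \<open>near_quarter\<close>;
    \<open>1 / \<theta>\<close> settles large scaled deficits, for which any segment will
    do.\<close>
  define C where "C = 128 + 1 / \<theta>"
  have C: "128 \<le> C" "1 / \<theta> \<le> C" using \<theta> by (auto simp: C_def)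
  \<comment> \<open>The inductive step at density at most 1/2, kept separate so that it serves both
    a family and the complement of a denser one.\<close>
  have small: "\<exists>r. coord_order V r \<and> meas V (sym_diff F (seg V r (card F))) \<le> C * deficit V F"
    if fin: "finite V" and F: "F \<subseteq> Pow V" and le: "meas V F \<le> 1/2"
      and IH: "\<And>j X. j \<in> V \<Longrightarrow> X \<subseteq> Pow (V - {j}) \<Longrightarrow>
        \<exists>r. coord_order (V - {j}) r \<and> meas (V - {j}) (sym_diff X (seg (V - {j}) r (card X))) \<le> C * deficit (V - {j}) X"
    for V and F :: "'a set set"
  proof -
    obtain r0 where r0: "coord_order V r0" using coord_order_exists[OF fin] by blast
    have d0: "0 \<le> deficit V F" using deficit_nonneg[OF fin F] .
    have meas_F: "meas V (seg V r (card F)) = meas V F" if "coord_order V r" for r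
    proof -
      have "card F \<le> 2 ^ card V" using card_mono[of "Pow V" F] fin F by (simp add: card_Pow)
      then show ?thesis using meas_seg[OF that] by (simp add: meas_def)
    qed
    \<comment> \<open>The error on the heavy half enters with weight 1/2, so the light side must be
      paid for by what the split adds beyond half the deficit of the heavy half.\<close>
    have reduce: ?thesis if j: "j \<in> V"
      and y: "meas (V - {j}) (half j (\<not> b) F) \<le> 128 * (deficit V F - deficit (V - {j}) (half j b F) / 2)" for j b
    proof -
      obtain r where r: "coord_order (V - {j}) r"
        "meas (V - {j}) (sym_diff (half j b F) (seg (V - {j}) r (card (half j b F)))) \<le> C * deficit (V - {j}) (half j b F)"
        using IH[OF j half_subset[OF F]] by blast
      have "0 \<le> deficit V F - deficit (V - {j}) (half j b F) / 2"
        using y meas_nonneg[of "V - {j}" "half j (\<not> b) F"] by argo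
      then have "128 * (deficit V F - deficit (V - {j}) (half j b F) / 2) \<le> C * (deficit V F - deficit (V - {j}) (half j b F) / 2)"
        using C(1) by (intro mult_right_mono)
      then have "meas V (sym_diff F (seg V ((j, b) # r) (card F))) \<le> C * deficit V F"
        using seg_extend[OF fin F j le r(1), of b] r(2) y by (simp add: right_diff_distrib)
      moreover have "coord_order V ((j, b) # r)" using r(1) j by (simp add: coord_order_Cons)
      ultimately show ?thesis by blast
    qed
    show ?thesis
    proof (cases "F = {}")
      case True
      then show ?thesis using r0 d0 C(1) by (intro exI[of _ r0]) (simp add: seg_def)
    next
      case False
      then have "0 < meas V F" using finite_family[OF fin F] by (simp add: meas_def card_gt_0_iff)
      then obtain k where k: "1/4 < 2 ^ k * meas V F" "2 ^ k * meas V F \<le> 1/2" using dyadic_scale le by blast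
      have unscale: "u \<le> v" if "2 ^ k * u \<le> 2 ^ k * v" for u v :: real using that by simp
      consider "2 ^ k * deficit V F > \<theta>"
        | "2 ^ k * deficit V F \<le> \<theta>" "2 ^ k * meas V F \<le> 1/4 + 1/2048"
        | "2 ^ k * deficit V F \<le> \<theta>" "2 ^ k * meas V F > 1/4 + 1/2048" by linarith
      then show ?thesis
      proof cases
        case 1
        have "meas V (sym_diff F (seg V r0 (card F))) \<le> 2 * meas V F"
          using meas_dist_le_add[OF fin F seg_subset] meas_F[OF r0] by (metis mult_2)
        also have "\<dots> \<le> C * deficit V F"
        proof (rule unscale)
          have "2 ^ k * (2 * meas V F) \<le> 1" using k(2) by simp
          also have "1 \<le> (1 / \<theta>) * (2 ^ k * deficit V F)" using 1 \<theta>(1) by (simp add: field_simps)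
          also have "\<dots> \<le> C * (2 ^ k * deficit V F)" using C(2) d0 by (intro mult_right_mono) auto
          finally show "2 ^ k * (2 * meas V F) \<le> 2 ^ k * (C * deficit V F)" by (simp add: mult_ac)
        qed
        finally show ?thesis using r0 by blast
      next
        case 2
        then have "2 ^ k * deficit V F \<le> 1/1024" using \<theta>(3) by linarith
        then obtain j b where j: "j \<in> V" and
          "meas (V - {j}) (half j (\<not> b) F) \<le> 128 * (deficit V F - deficit (V - {j}) (half j b F) / 2)
           \<or> (\<exists>K. subcube V K \<and> meas V (sym_diff F K) \<le> 14 * deficit V F)"
          using near_quarter[OF fin F, of k] k(1) 2(2) by (meson less_imp_le)
        then consider "meas (V - {j}) (half j (\<not> b) F) \<le> 128 * (deficit V F - deficit (V - {j}) (half j b F) / 2)"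
          | K where "subcube V K" "meas V (sym_diff F K) \<le> 14 * deficit V F" by blast
        then show ?thesis
        proof cases
          case 1
          then show ?thesis using reduce[OF j] by blast
        next
          case (2 K)
          obtain r where r: "coord_order V r" "K = seg V r (card K)" using subcube_is_seg[OF fin 2(1)] by blast
          have KV: "K \<subseteq> Pow V" using subcube_subset[OF 2(1)] .
          \<comment> \<open>Resizing the segment \<open>K\<close> to the size of \<open>F\<close>
            costs no more than its distance from \<open>F\<close>, whence 28 = 14 + 14.\<close>
          have "meas V (sym_diff K (seg V r (card F))) = \<bar>meas V K - meas V F\<bar>"
            using meas_dist_seg[OF r(1), of "card K" "card F"] r(2) meas_F[OF r(1)] by simp
          also have "\<dots> \<le> meas V (sym_diff F K)"
            using abs_meas_diff_le[OF fin F KV] by (simp add: abs_minus_commute)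
          finally have "meas V (sym_diff F (seg V r (card F))) \<le> 28 * deficit V F"
            using meas_dist_triangle[OF fin F KV seg_subset, of r "card F"] 2(2) by linarith
          also have "\<dots> \<le> C * deficit V F" using C(1) d0 by (intro mult_right_mono) auto
          finally show ?thesis using r(1) by blast
        qed
      next
        case 3
        have M: "1/4 + 1/2048 \<le> 2 ^ k * meas V F" using 3(2) by simp
        have "2 ^ k * deficit V F \<le> \<eta>" using 3(1) \<theta>(2) by linarith
        then obtain j c where j: "j \<in> V" and c: "2 ^ k * meas (V - {j}) (half j c F) \<le> 1/8192"
          using rough[OF fin F M k(2)] by blast
        define X where "X = half j (\<not> c) F"
        define y where "y = meas (V - {j}) (half j c F)"
        have "2 ^ k * y \<le> 2 * (2 ^ k * deficit V F - 2 ^ k * deficit (V - {j}) X / 2)"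
          using light_side_gap[OF fin F j M k(2), of "\<not> c"] c by (simp add: X_def y_def)
        also have "\<dots> = 2 ^ k * (2 * (deficit V F - deficit (V - {j}) X / 2))" by (simp add: algebra_simps)
        finally have "y \<le> 2 * (deficit V F - deficit (V - {j}) X / 2)" by (rule unscale)
        moreover have "0 \<le> y" by (simp add: y_def)
        ultimately have "y \<le> 128 * (deficit V F - deficit (V - {j}) X / 2)" by argo
        then show ?thesis using reduce[OF j, of "\<not> c"] by (simp add: X_def y_def)
      qed
    qed
  qed
  have "\<exists>r. coord_order V r \<and> meas V (sym_diff F (seg V r (card F))) \<le> C * deficit V F"
    if "finite V" "F \<subseteq> Pow V" for V and F :: "'a set set"
    using that
  proof (induction "card V" arbitrary: V F rule: less_induct)
    case less
    note fin = less.prems(1) and F = less.prems(2)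
    have IH: "\<exists>r. coord_order (V - {j}) r \<and> meas (V - {j}) (sym_diff X (seg (V - {j}) r (card X))) \<le> C * deficit (V - {j}) X"
      if "j \<in> V" "X \<subseteq> Pow (V - {j})" for j X
      using less.hyps[of "V - {j}" X] that fin card_Diff1_less[OF fin] by simp
    show ?case
    proof (cases "meas V F \<le> 1/2")
      case True
      then show ?thesis using small[OF fin F] IH by blast
    next
      case False
      \<comment> \<open>The reversed order turns the segment near the complement into one near
        \<open>F\<close>.\<close>
      define F' where "F' = Pow V - F"
      have F': "F' \<subseteq> Pow V" by (auto simp: F'_def)
      have "meas V F' \<le> 1/2" using meas_compl[OF fin F] False by (simp add: F'_def)
      then obtain r where r: "coord_order V r" "meas V (sym_diff F' (seg V r (card F'))) \<le> C * deficit V F'"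
        using small[OF fin F'] IH by blast
      let ?r = "map (\<lambda>(i, b). (i, \<not> b)) r"
      have finF: "finite F" and cF: "card F \<le> 2 ^ card V"
        using finite_family[OF fin F] card_mono[of "Pow V" F] fin F by (auto simp: card_Pow)
      have cF': "card F' = 2 ^ card V - card F" using card_Diff_subset[OF finF F] fin by (simp add: F'_def card_Pow)
      then have "Pow V - seg V r (card F') = seg V ?r (card F)" using seg_compl[OF r(1), of "card F'"] cF by simp
      moreover have "sym_diff F (Pow V - S) = sym_diff (Pow V - F) S" if "S \<subseteq> Pow V" for S using F that by auto
      ultimately have "sym_diff F (seg V ?r (card F)) = sym_diff F' (seg V r (card F'))"
        using seg_subset by (metis F'_def)
      then show ?thesis
        using r coord_order_flip[of V r] deficit_compl[OF fin F] by (intro exI[of _ ?r]) (simp add: F'_def)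
    qed
  qed
  then show ?thesis using C(1) by (intro exI[of _ C]) auto
qed

section \<open>Back to edge counts, the lexicographic order and weak isomorphism\<close>

lemma card_edge_boundary:
  assumes "F \<subseteq> Pow {1..n}"
  shows "card (edge_boundary n F) = 2 ^ n * bdry {1..n} F"
proof -
  let ?V = "{1..n}"
  \<comment> \<open>A boundary edge has exactly one endpoint in \<open>F\<close>; it is encoded by
    its direction and that endpoint.\<close>
  define A where "A i = {S \<in> F. sym_diff S {i} \<notin> F}" for i
  define g where "g = (\<lambda>(i, S). {S, sym_diff S {i :: nat}})"
  have finF: "finite F" using finite_family[OF _ assms] by simp
  have "edge_boundary n F = g ` (SIGMA i:?V. A i)"
  proof (intro equalityI subsetI)
    fix e assume "e \<in> edge_boundary n F"
    then obtain S T where ST: "e = {S, T}" "T \<subseteq> ?V" "card (sym_diff S T) = 1" "S \<in> F" "T \<notin> F"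
      by (auto simp: edge_boundary_def cube_adj_def)
    then obtain i where i: "sym_diff S T = {i}" by (auto simp: card_1_singleton_iff)
    have "T = sym_diff S {i}" using i by auto
    moreover have "i \<in> ?V" using i ST(2,4) assms by blast
    ultimately show "e \<in> g ` (SIGMA i:?V. A i)" using ST by (auto simp: g_def A_def intro!: image_eqI[of _ _ "(i, S)"])
  next
    fix e assume "e \<in> g ` (SIGMA i:?V. A i)"
    then obtain i S where iS: "i \<in> ?V" "S \<in> F" "sym_diff S {i} \<notin> F" "e = {S, sym_diff S {i}}"
      by (auto simp: g_def A_def)
    have "sym_diff S (sym_diff S {i}) = {i}" by auto
    then have "card (sym_diff S (sym_diff S {i})) = 1" by simp
    moreover have "S \<in> Pow ?V" "sym_diff S {i} \<in> Pow ?V" using iS assms by auto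
    ultimately show "e \<in> edge_boundary n F" unfolding edge_boundary_def cube_adj_def using iS by blast
  qed
  moreover have "inj_on g (SIGMA i:?V. A i)"
  proof (rule inj_onI, clarify)
    fix i S j T assume a: "S \<in> A i" "T \<in> A j" "g (i, S) = g (j, T)"
    then have "S = T" "sym_diff S {i} = sym_diff T {j}" by (auto simp: g_def A_def doubleton_eq_iff)
    then show "i = j \<and> S = T" by blast
  qed
  ultimately have "card (edge_boundary n F) = (\<Sum>i\<in>?V. card (A i))"
    using finF by (simp add: card_image A_def)
  \<comment> \<open>Deleting \<open>i\<close> is injective on \<open>A i\<close>, because two sets
    differing only at \<open>i\<close> would both belong to \<open>F\<close>.\<close>
  moreover have "card (A i) = card (sym_diff (half i True F) (half i False F))" for i
  proof (rule bij_betw_same_card[of "\<lambda>S. S - {i}"], rule bij_betw_imageI)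
    show "inj_on (\<lambda>S. S - {i}) (A i)"
    proof (rule inj_onI, rule ccontr)
      fix S T assume a: "S \<in> A i" "T \<in> A i" "S - {i} = T - {i}" "S \<noteq> T"
      then have "T = sym_diff S {i}" by blast
      then show False using a by (simp add: A_def)
    qed
    show "(\<lambda>S. S - {i}) ` A i = sym_diff (half i True F) (half i False F)"
    proof (intro equalityI subsetI)
      fix S assume "S \<in> sym_diff (half i True F) (half i False F)"
      then consider "i \<notin> S" "insert i S \<in> F" "S \<notin> F" | "i \<notin> S" "insert i S \<notin> F" "S \<in> F"
        by (auto simp: half_def)
      then show "S \<in> (\<lambda>S. S - {i}) ` A i"
      proof cases
        case 1
        then have "sym_diff (insert i S) {i} = S" by auto
        then have "insert i S \<in> A i" using 1 by (simp add: A_def)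
        then show ?thesis using 1 by (intro image_eqI[of _ _ "insert i S"]) auto
      next
        case 2
        then have "sym_diff S {i} = insert i S" by auto
        then have "S \<in> A i" using 2 by (simp add: A_def)
        then show ?thesis using 2 by (intro image_eqI[of _ _ S]) auto
      qed
    next
      fix T assume "T \<in> (\<lambda>S. S - {i}) ` A i"
      then obtain S where S: "S \<in> F" "sym_diff S {i} \<notin> F" "T = S - {i}" by (auto simp: A_def)
      show "T \<in> sym_diff (half i True F) (half i False F)"
      proof (cases "i \<in> S")
        case True
        then have "sym_diff S {i} = T" "insert i T = S" using S by auto
        then show ?thesis using S by (auto simp: half_def)
      next
        case False
        then have "sym_diff S {i} = insert i T" "T = S" using S by auto
        then show ?thesis using S False by (auto simp: half_def)
      qed
    qed
  qed
  moreover have dir: "real (card X) = 2 ^ n * (meas (?V - {i}) X / 2)" if "i \<in> ?V" for i X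
  proof -
    have "n = Suc (card (?V - {i}))" using that by simp
    then have "(2::real) ^ n = 2 * 2 ^ card (?V - {i})" by (metis power_Suc)
    then show ?thesis by (simp add: meas_def)
  qed
  ultimately have "real (card (edge_boundary n F)) = (\<Sum>i\<in>?V. real (card (sym_diff (half i True F) (half i False F))))"
    by simp
  also have "\<dots> = (\<Sum>i\<in>?V. 2 ^ n * (meas (?V - {i}) (sym_diff (half i True F) (half i False F)) / 2))"
    by (intro sum.cong refl dir)
  finally show ?thesis unfolding bdry_def by (simp only: sum_distrib_left sum_divide_distrib)
qed

abbreviation std_order :: "nat \<Rightarrow> nat \<Rightarrow> (nat \<times> bool) list" where
  "std_order a b \<equiv> map (\<lambda>i. (i, True)) [a..<b]"

lemma coord_order_std: "coord_order {1..n} (std_order 1 (Suc n))"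
  by (auto simp: coord_order_def comp_def image_image simp del: upt_Suc)

text \<open>Less significant digits cannot outweigh the first difference, so smaller rank means
  lexicographically greater.\<close>

lemma lex_rank_std_less:
  assumes "lex_rank (std_order a b) S < lex_rank (std_order a b) T"
  shows "\<exists>c\<ge>a. c \<in> S \<and> c \<notin> T \<and> (\<forall>x. a \<le> x \<and> x < c \<longrightarrow> (x \<in> S \<longleftrightarrow> x \<in> T))"
  using assms
proof (induction "b - a" arbitrary: a)
  case (Suc d)
  then have ab: "a < b" by simp
  let ?r = "std_order (Suc a) b"
  have eq: "lex_rank (std_order a b) U = (if a \<in> U then 0 else 2 ^ length ?r) + lex_rank ?r U" for U
    using ab by (simp add: upt_conv_Cons)
  have less: "lex_rank ?r U < 2 ^ length ?r" for U by (rule lex_rank_less)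
  consider "a \<in> S" "a \<notin> T" | "a \<in> S \<longleftrightarrow> a \<in> T" | "a \<notin> S" "a \<in> T" by blast
  then show ?case
  proof cases
    case 1
    then show ?thesis by (intro exI[of _ a]) auto
  next
    case 2
    then have "lex_rank ?r S < lex_rank ?r T" using Suc.prems unfolding eq by (auto split: if_splits)
    moreover have "d = b - Suc a" using Suc.hyps(2) by arith
    ultimately obtain c where c: "Suc a \<le> c" "c \<in> S" "c \<notin> T" "\<forall>x. Suc a \<le> x \<and> x < c \<longrightarrow> (x \<in> S \<longleftrightarrow> x \<in> T)"
      using Suc.hyps(1)[of "Suc a"] by auto
    moreover have "x \<in> S \<longleftrightarrow> x \<in> T" if "a \<le> x" "x < c" for x
      using that c(4) 2 by (cases "x = a") auto
    ultimately show ?thesis by (intro exI[of _ c]) auto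
  next
    case 3
    then show ?thesis using Suc.prems less[of T] unfolding eq by simp
  qed
qed simp

lemma lex_initial_segment_seg:
  assumes "m \<le> 2 ^ n"
  shows "lex_initial_segment n m (seg {1..n} (std_order 1 (Suc n)) m)"
proof -
  let ?r = "std_order 1 (Suc n)"
  have greater: "lex_greater S T" if ST: "S \<subseteq> {1..n}" "T \<subseteq> {1..n}" "lex_rank ?r S < lex_rank ?r T" for S T
  proof -
    obtain c where c: "c \<in> S" "c \<notin> T" "\<forall>x. 1 \<le> x \<and> x < c \<longrightarrow> (x \<in> S \<longleftrightarrow> x \<in> T)"
      using lex_rank_std_less[OF ST(3)] by blast
    \<comment> \<open>Coordinates start at 1, so 0 belongs to neither set.\<close>
    moreover have "x \<in> S \<longleftrightarrow> x \<in> T" if "x < c" for x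
      using c(3) that ST by (cases "x = 0") auto
    moreover have "finite S" "finite T" using ST by (auto intro: finite_subset)
    ultimately show ?thesis using lex_greater_iff by blast
  qed
  have "lex_greater S T" if "S \<in> seg {1..n} ?r m" "T \<in> Pow {1..n} - seg {1..n} ?r m" for S T
  proof -
    have "lex_rank ?r S < m" "\<not> lex_rank ?r T < m" "S \<subseteq> {1..n}" "T \<subseteq> {1..n}"
      using that unfolding seg_def by blast+
    then show ?thesis using greater[of S T] by linarith
  qed
  moreover have "card (seg {1..n} ?r m) = m"
    using card_seg[OF coord_order_std, of n m] assms by (simp only: card_atLeastAtMost diff_Suc_1 min_absorb1)
  ultimately show ?thesis unfolding lex_initial_segment_def using seg_subset by blast
qed

text \<open>The rank depends only on the pattern of agreement with the preferences, so orders on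
  different coordinates can be compared.\<close>

lemma lex_rank_cong_list:
  assumes "list_all2 (\<lambda>(i, b) (i', b'). ((i \<in> S) = b) = ((i' \<in> S') = b')) r r'"
  shows "lex_rank r S = lex_rank r' S'"
  using assms
proof (induction rule: list_all2_induct)
  case (Cons p r p' r')
  then show ?case using list_all2_lengthD[OF Cons(2)] by (cases p; cases p') auto
qed simp

text \<open>Send each coordinate to the one in the same position of \<open>r\<close>, then translate
  by the coordinates that \<open>r\<close> prefers absent. This preserves ranks, hence
  segments.\<close>

lemma weakly_isomorphic_seg:
  assumes "coord_order {1..n} r"
  shows "weakly_isomorphic n (seg {1..n} (std_order 1 (Suc n)) m) (seg {1..n} r m)"
proof -
  let ?V = "{1..n}" and ?r0 = "std_order 1 (Suc n)"
  have len: "length r = n" using coord_order_length[OF assms] by simp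
  have dist: "distinct (map fst r)" and set: "fst ` set r = ?V" using assms by (auto simp: coord_order_def)
  \<comment> \<open>List positions start at 0 and coordinates at 1, hence the shift by one.\<close>
  define p where "p k = (if k \<in> ?V then fst (r ! (k - 1)) else k)" for k
  define D where "D = {i \<in> ?V. (i, False) \<in> set r}"
  have inj: "inj_on p ?V"
  proof (rule inj_onI)
    fix k l assume kl: "k \<in> ?V" "l \<in> ?V" "p k = p l"
    then have "map fst r ! (k - 1) = map fst r ! (l - 1)" using len by (auto simp: p_def)
    then have "k - 1 = l - 1" using dist kl(1,2) len by (subst (asm) nth_eq_iff_index_eq) auto
    then show "k = l" using kl by auto
  qed
  have "p k \<in> ?V" if "k \<in> ?V" for k
  proof -
    have "r ! (k - 1) \<in> set r" using that len by (intro nth_mem) auto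
    then show ?thesis using that set by (simp add: p_def) (metis atLeastAtMost_iff image_eqI One_nat_def)
  qed
  then have "p ` ?V \<subseteq> ?V" by blast
  then have "bij_betw p ?V ?V" using inj by (simp add: bij_betw_def endo_inj_surj)
  then have p: "p permutes ?V" by (rule bij_imp_permutes) (auto simp: p_def)
  have D: "D \<subseteq> ?V" by (auto simp: D_def)
  define \<phi> where "\<phi> S = sym_diff (p ` S) D" for S
  have aut: "cube_automorphism n \<phi>" unfolding \<phi>_def using cube_automorphism_perm_translate[OF p D] .
  have rank: "lex_rank r (\<phi> S) = lex_rank ?r0 S" if "S \<subseteq> ?V" for S
  proof (rule lex_rank_cong_list, unfold list_all2_conv_all_nth, intro conjI allI impI)
    show "length r = length ?r0" using len by simp
    fix k assume k: "k < length r"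
    obtain i b where ib: "r ! k = (i, b)" by (cases "r ! k")
    have kV: "Suc k \<in> ?V" using k len by simp
    have i: "i = p (Suc k)" using ib kV by (simp add: p_def)
    have iV: "i \<in> ?V" using set k ib by (metis fst_conv image_eqI nth_mem)
    have "p (Suc k) \<in> p ` S \<longleftrightarrow> Suc k \<in> S"
      using inj that kV by (auto dest: inj_onD)
    moreover have "(i, False) \<in> set r \<longleftrightarrow> \<not> b"
    proof
      assume "(i, False) \<in> set r"
      moreover have "(i, b) \<in> set r" using ib k by (metis nth_mem)
      ultimately show "\<not> b" using dist by (metis eq_key_imp_eq_value)
    qed (use ib k in \<open>metis (full_types) nth_mem\<close>)
    ultimately have "(i \<in> \<phi> S) = ((Suc k \<in> S) = b)" using iV i by (auto simp: \<phi>_def D_def)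
    moreover have "?r0 ! k = (Suc k, True)" using k len by (simp del: upt_Suc)
    ultimately show "(case r ! k of (i, b) \<Rightarrow> \<lambda>(i', b'). ((i \<in> \<phi> S) = b) = ((i' \<in> S) = b')) (?r0 ! k)"
      using ib by auto
  qed
  have bij: "bij_betw \<phi> (Pow ?V) (Pow ?V)" using aut by (simp add: cube_automorphism_def)
  have "seg ?V r m = \<phi> ` seg ?V ?r0 m"
  proof (intro equalityI subsetI)
    fix T assume T: "T \<in> seg ?V r m"
    then obtain S where "S \<in> Pow ?V" "T = \<phi> S" using bij unfolding bij_betw_def seg_def by blast
    then show "T \<in> \<phi> ` seg ?V ?r0 m" using T rank by (auto simp: seg_def simp del: upt_Suc)
  next
    fix T assume "T \<in> \<phi> ` seg ?V ?r0 m"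
    then obtain S where S: "S \<subseteq> ?V" "lex_rank ?r0 S < m" "T = \<phi> S" unfolding seg_def by blast
    then show "T \<in> seg ?V r m" using bij_betw_apply[OF bij, of S] rank[OF S(1)] by (simp add: seg_def del: upt_Suc)
  qed
  then show ?thesis unfolding weakly_isomorphic_def using aut by blast
qed

theorem theorem1p5:
  shows "\<exists>C::real. C > 0 \<and>
    (\<forall>n::nat. \<forall>F L :: nat set set.
       F \<subseteq> Pow {1..n} \<longrightarrow> lex_initial_segment n (card F) L \<longrightarrow>
       (\<exists>G \<subseteq> Pow {1..n}. weakly_isomorphic n L G \<and>
          real (card (sym_diff F G))
            \<le> C * (real (card (edge_boundary n F)) - real (card (edge_boundary n L)))))"
proof -
  obtain C where C: "C > 0" and stab: "\<And>V (F :: nat set set). finite V \<Longrightarrow> F \<subseteq> Pow V \<Longrightarrow>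
     \<exists>r. coord_order V r \<and> meas V (sym_diff F (seg V r (card F))) \<le> C * deficit V F"
    using seg_stability by metis
  have "\<exists>G \<subseteq> Pow {1..n}. weakly_isomorphic n L G \<and>
      real (card (sym_diff F G)) \<le> C * (real (card (edge_boundary n F)) - real (card (edge_boundary n L)))"
    if F: "F \<subseteq> Pow {1..n}" and L: "lex_initial_segment n (card F) L" for n and F L :: "nat set set"
  proof -
    let ?V = "{1..n}" and ?r0 = "std_order 1 (Suc n)"
    have cF: "card F \<le> 2 ^ n" using card_mono[of "Pow ?V" F] F by (simp add: card_Pow)
    have L_eq: "L = seg ?V ?r0 (card F)"
      using lex_initial_segment_unique[OF L lex_initial_segment_seg[OF cF]] .
    obtain r where r: "coord_order ?V r" "meas ?V (sym_diff F (seg ?V r (card F))) \<le> C * deficit ?V F"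
      using stab[OF _ F] by auto
    \<comment> \<open>The boundary of \<open>L\<close> is exactly the Takagi term subtracted in the
      deficit of \<open>F\<close>, so the deficit is the normalised difference of the two
      boundaries.\<close>
    have "bdry ?V L = tak (meas ?V F)"
      using bdry_seg[OF coord_order_std, of "card F" n] cF by (simp add: L_eq meas_def del: upt_Suc)
    then have "2 ^ n * deficit ?V F = real (card (edge_boundary n F)) - real (card (edge_boundary n L))"
      using card_edge_boundary[OF F] card_edge_boundary[of L n] L
      by (simp add: deficit_def lex_initial_segment_def right_diff_distrib)
    moreover have "real (card (sym_diff F (seg ?V r (card F)))) \<le> C * (2 ^ n * deficit ?V F)"
      using r(2) by (simp add: meas_def field_simps)
    ultimately have "real (card (sym_diff F (seg ?V r (card F))))
        \<le> C * (real (card (edge_boundary n F)) - real (card (edge_boundary n L)))" by simp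
    moreover have "weakly_isomorphic n L (seg ?V r (card F))"
      unfolding L_eq by (rule weakly_isomorphic_seg[OF r(1)])
    ultimately show ?thesis using seg_subset by blast
  qed
  then show ?thesis using C by blast
qed

end
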